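(* Setting: integers $N,Q,S\ge1$, $1\le M\le N$, $J\ge1$; $\mathbf{H}\in\mathbb{R}^{Q\times N}\setminus\{\mathbf{0}\}$, $\mathbf{y}\in\mathbb{R}^Q$, a real matrix $\mathbf{V}_0$ with $N$ columns, and for $s\in\{1,\dots,S\}$: $P_s\ge1$, $\mathbf{V}_s\in\mathbb{R}^{P_s\times N}$, $\mathbf{c}_s\in\mathbb{R}^{P_s}$; $\Phi:\mathbb{R}^Q\to\mathbb{R}$; functions $\psi_{s,\delta}:\mathbb{R}\to\mathbb{R}$ for $\delta>0$; $F_\delta(\mathbf{x})=\Phi(\mathbf{H}\mathbf{x}-\mathbf{y})+\sum_{s=1}^S\psi_{s,\delta}(\|\mathbf{V}_s\mathbf{x}-\mathbf{c}_s\|)+\|\mathbf{V}_0\mathbf{x}\|^2$. Assume: (A1i) $\Phi$ is continuous and coercive; (A1ii) for every $\delta>0$ and $s$, $\psi_{s,\delta}$ is continuous and nonnegative; (A1iii) $\operatorname{Ker}\mathbf{H}\cap\operatorname{Ker}\mathbf{V}_0=\{\mathbf{0}\}$. Fix $\delta>0$ and assume: (A3i) $\Phi$ is differentiable with $L$-Lipschitz gradient; (A3ii) each $\psi_{s,\delta}$ is differentiable; (A3iii) each $t\mapsto\psi_{s,\delta}(\sqrt t)$ is concave on $[0,+\infty)$; (A3iv) for each $s$ there is $\overline\omega_s\in[0,+\infty)$ with $0\le\dot\psi_{s,\delta}(t)\le\overline\omega_s t$ for all $t>0$, and $\lim_{t\to0}\dot\psi_{s,\delta}(t)/t\in\mathbb{R}$.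 Assume moreover that $F_\delta$ satisfies the Kurdyka–Łojasiewicz inequality. Let $\omega_{s,\delta}(t)=\dot\psi_{s,\delta}(t)/t$, extended by continuity at $0$, fix $\mu\in[L,+\infty)$ and set $\mathbf{A}(\mathbf{x})=\mu\mathbf{H}^\top\mathbf{H}+2\mathbf{V}_0^\top\mathbf{V}_0+\mathbf{V}^\top\operatorname{Diag}\{\mathbf{b}(\mathbf{x})\}\mathbf{V}$, where $\mathbf{V}=[\mathbf{V}_1^\top|\cdots|\mathbf{V}_S^\top]^\top$ and $b_{P_1+\dots+P_{s-1}+p}(\mathbf{x})=\omega_{s,\delta}(\|\mathbf{V}_s\mathbf{x}-\mathbf{c}_s\|)$ for $p\in\{1,\dots,P_s\}$. Consider the MM subspace iteration: $\mathbf{x}_0\in\mathbb{R}^N$; for each $k\in\mathbb{N}$, given a matrix $\mathbf{D}_k\in\mathbb{R}^{N\times M}$, set $\mathbf{u}_k^0=\mathbf{0}$ and for $j=1,\dots,J$: $\mathbf{B}_k^{j-1}=\mathbf{D}_k^\top\mathbf{A}(\mathbf{x}_k+\mathbf{D}_k\mathbf{u}_k^{j-1})\mathbf{D}_k$, $\mathbf{u}_k^j=\mathbf{u}_k^{j-1}-(\mathbf{B}_k^{j-1})^{\dagger}\mathbf{D}_k^\top\nabla F_\delta(\mathbf{x}_k+\mathbf{D}_k\mathbf{u}_k^{j-1})$ (pseudo-inverse $\dagger$); then $\mathbf{x}_{k+1}=\mathbf{x}_k+\mathbf{D}_k\mathbf{u}_k^J$. Let $\mathbf{g}_k=\nabla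 F_\delta(\mathbf{x}_k)$ and assume (A4) there exist $\gamma_0>0,\gamma_1>0$ such that for every $k$ the first column $\mathbf{d}_k^1$ of $\mathbf{D}_k$ satisfies $\mathbf{g}_k^\top\mathbf{d}_k^1\le-\gamma_0\|\mathbf{g}_k\|^2$ and $\|\mathbf{d}_k^1\|\le\gamma_1\|\mathbf{g}_k\|$. Claim: the sequence $(\mathbf{x}_k)_{k\in\mathbb{N}}$ converges to a critical point $\tilde{\mathbf{x}}$ of $F_\delta$ (i.e. $\nabla F_\delta(\tilde{\mathbf{x}})=\mathbf{0}$), and it has finite length: $\sum_{k=0}^{+\infty}\|\mathbf{x}_{k+1}-\mathbf{x}_k\|<+\infty$.
   Context: $\|\cdot\|$ is the Euclidean norm; $\dot\psi_{s,\delta}$ is the derivative of $\psi_{s,\delta}$. A differentiable function $G:\mathbb{R}^N\to\mathbb{R}$ satisfies the Kurdyka–Łojasiewicz inequality if for every $\tilde{\mathbf{x}}\in\mathbb{R}^N$ and every bounded neighborhood $E$ of $\tilde{\mathbf{x}}$ there exist constants $\kappa>0$, $\zeta>0$ and $\theta\in[0,1)$ such that $\|\nabla G(\mathbf{x})\|\ge\kappa|G(\mathbf{x})-G(\tilde{\mathbf{x}})|^\theta$ for every $\mathbf{x}\in E$ with $|G(\mathbf{x})-G(\tilde{\mathbf{x}})|<\zeta$. *)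

theory Defs
  imports "HOL-Analysis.Analysis"
begin

text \<open>Gradient of a real-valued function on a Euclidean space (unique when it exists).\<close>
definition grad :: "('a::real_inner \<Rightarrow> real) \<Rightarrow> 'a \<Rightarrow> 'a" where
  "grad f x = (THE D. GDERIV f x :> D)"

text \<open>Coercivity: f(z) tends to +infinity as norm z tends to infinity.\<close>
definition coercive :: "('a::real_normed_vector \<Rightarrow> real) \<Rightarrow> bool" where
  "coercive f \<longleftrightarrow> filterlim f at_top at_infinity"

text \<open>Moore--Penrose pseudo-inverse of a square real matrix.\<close>
definition pinv :: "real^'m^'m \<Rightarrow> real^'m^'m" where
  "pinv B = (THE X. B ** X ** B = B \<and> X ** B ** X = X \<and>
                    transpose (B ** X) = B ** X \<and> transpose (X ** B) = X ** B)"

text \<open>Diagonal matrix Diag{b}.\<close>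
definition Diag :: "real^'p \<Rightarrow> real^'p^'p" where
  "Diag b = (\<chi> i j. if i = j then b $ i else 0)"

text \<open>Kurdyka--Lojasiewicz inequality, as in the paper's context.
  A neighbourhood E of xt is a set containing an open set that contains xt.\<close>
definition KL :: "('a::real_inner \<Rightarrow> real) \<Rightarrow> bool" where
  "KL G \<longleftrightarrow> (\<forall>xt E. bounded E \<and> (\<exists>U. open U \<and> xt \<in> U \<and> U \<subseteq> E) \<longrightarrow>
     (\<exists>\<kappa>>0. \<exists>\<zeta>>0. \<exists>\<theta>. 0 \<le> \<theta> \<and> \<theta> < 1 \<and>
        (\<forall>x\<in>E. \<bar>G x - G xt\<bar> < \<zeta> \<longrightarrow> norm (grad G x) \<ge> \<kappa> * \<bar>G x - G xt\<bar> powr \<theta>)))"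

text \<open>The stacked matrix V has rows indexed by 'p; grp p is the block s to which
  row p belongs. Block norm: norm (V_s x - c_s).\<close>
definition blocknorm :: "('p \<Rightarrow> 's) \<Rightarrow> real^'n^'p \<Rightarrow> real^'p \<Rightarrow> 's \<Rightarrow> real^'n \<Rightarrow> real" where
  "blocknorm grp V c s x = sqrt (\<Sum>p\<in>{p. grp p = s}. ((V *v x - c) $ p)\<^sup>2)"

text \<open>The objective F_delta.\<close>
definition Fdelta :: "(real^'q \<Rightarrow> real) \<Rightarrow> real^'n^'q \<Rightarrow> real^'q \<Rightarrow> real^'n^'r
    \<Rightarrow> ('p \<Rightarrow> 's::finite) \<Rightarrow> real^'n^'p \<Rightarrow> real^'p \<Rightarrow> ('s \<Rightarrow> real \<Rightarrow> real \<Rightarrow> real) \<Rightarrow> real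
    \<Rightarrow> real^'n \<Rightarrow> real" where
  "Fdelta \<Phi> H y V0 grp V c \<psi> \<delta> x =
     \<Phi> (H *v x - y) + (\<Sum>s\<in>UNIV. \<psi> s \<delta> (blocknorm grp V c s x)) + (norm (V0 *v x))\<^sup>2"

text \<open>omega(t) = psi'(t)/t, extended by continuity at 0.\<close>
definition omega :: "(real \<Rightarrow> real) \<Rightarrow> real \<Rightarrow> real" where
  "omega f t = (if t = 0 then Lim (at 0) (\<lambda>r. deriv f r / r) else deriv f t / t)"

text \<open>The curvature matrix A(x).\<close>
definition Amat :: "real \<Rightarrow> real^'n^'q \<Rightarrow> real^'n^'r \<Rightarrow> ('p \<Rightarrow> 's) \<Rightarrow> real^'n^'p \<Rightarrow> real^'p
    \<Rightarrow> ('s \<Rightarrow> real \<Rightarrow> real \<Rightarrow> real) \<Rightarrow> real \<Rightarrow> real^'n \<Rightarrow> real^'n^'n" where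
  "Amat \<mu> H V0 grp V c \<psi> \<delta> x =
     \<mu> *\<^sub>R (transpose H ** H) + 2 *\<^sub>R (transpose V0 ** V0)
     + transpose V ** Diag (\<chi> p. omega (\<psi> (grp p) \<delta>) (blocknorm grp V c (grp p) x)) ** V"

end

theory Submission
  imports Defs
begin

text \<open>
  Each inner step minimizes, over the range of \<open>D k\<close>, the quadratic model of \<open>F\<close> with curvature
  \<open>A\<close>. The Lipschitz gradient of \<open>\<Phi>\<close> and the concavity of \<open>t \<mapsto> \<psi>(\<surd>t)\<close> make this model a
  majorant, and \<open>A\<close> is bounded above and, by (A1iii), uniformly below. Comparing with a multiple
  of the first column of \<open>D k\<close> shows that each outer step decreases \<open>F\<close> by at least
  \<open>a \<parallel>\<nabla>F(x k)\<parallel>\<^sup>2\<close> while moving \<open>x k\<close> by at most \<open>c \<surd>(F(x k) - F(x (k+1)))\<close>.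
  Coercivity bounds the iterates, so \<open>F(x k)\<close> decreases to the value at a cluster point; there
  the Kurdyka--Lojasiewicz inequality and the concavity of \<open>t\<^sup>1\<^sup>-\<^sup>\<theta>\<close> turn the two estimates into
  a telescoping bound on the step lengths. Finite length gives convergence, and the majorants at
  the iterates pass to the limit as a quadratic upper bound at the limit point, which forces the
  gradient there to vanish.
\<close>

section \<open>Symmetric matrices and the pseudo-inverse\<close>

lemma inner_matrix_vector_transpose: "(A *v x) \<bullet> (y::real^'a) = x \<bullet> (transpose A *v y)"
  by (metis dot_lmul_matrix inner_commute transpose_matrix_vector)

lemma transpose_add: "transpose (X + Y :: real^'a^'b) = transpose X + transpose Y"
  by (simp add: transpose_def vec_eq_iff)

lemma transpose_Diag: "transpose (Diag b) = Diag b"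
  by (simp add: transpose_def Diag_def vec_eq_iff)

lemma Diag_matrix_vector_mult: "Diag b *v v = (\<chi> i. b $ i * v $ i)"
proof -
  have "(if P then a else 0) * c = (if P then a * c else (0::real))" for P a c by simp
  then show ?thesis by (simp add: Diag_def matrix_vector_mult_def vec_eq_iff)
qed

lemma power2_norm_vec: "(norm (v::real^'a))\<^sup>2 = (\<Sum>i\<in>UNIV. (v $ i)\<^sup>2)"
  unfolding power2_norm_eq_inner inner_vec_def by (simp add: power2_eq_square)

lemma power2_norm_matrix_vector_le:
  fixes M :: "real^'n^'m"
  shows "(norm (M *v d))\<^sup>2 \<le> (onorm ((*v) M))\<^sup>2 * (norm d)\<^sup>2"
  using onorm[OF matrix_vector_mul_bounded_linear, of M d]
  by (simp add: power_mono flip: power_mult_distrib)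

lemma matrix_self_adjoint_imp_symmetric:
  fixes M :: "real^'m^'m"
  assumes "\<And>y z. (M *v y) \<bullet> z = y \<bullet> (M *v z)"
  shows "transpose M = M"
proof -
  have "transpose M *v z = M *v z" for z
  proof -
    have "y \<bullet> (transpose M *v z - M *v z) = 0" for y
      using assms[of y z] inner_matrix_vector_transpose[of M y z]
      by (simp add: inner_diff_right)
    then show ?thesis by (metis inner_eq_zero_iff right_minus_eq)
  qed
  then show ?thesis by (simp add: matrix_eq)
qed

lemma orthogonal_projection_exists:
  fixes S :: "'a::euclidean_space set"
  assumes S: "subspace S"
  obtains P where "linear P" "\<And>y. P y \<in> S" "\<And>y w. w \<in> S \<Longrightarrow> (y - P y) \<bullet> w = 0"
    "\<And>s. s \<in> S \<Longrightarrow> P s = s" "\<And>y z. P y \<bullet> z = y \<bullet> P z"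
proof -
  have ex: "\<exists>p. p \<in> S \<and> (\<forall>w\<in>S. (y - p) \<bullet> w = 0)" for y
  proof -
    obtain p z where "p \<in> span S" "\<And>w. w \<in> span S \<Longrightarrow> orthogonal z w" "y = p + z"
      using orthogonal_subspace_decomp_exists by blast
    moreover have "span S = S" using S by simp
    ultimately show ?thesis by (intro exI[of _ p]) (auto simp: orthogonal_def)
  qed
  have uniq: "p = p'" if "p \<in> S" "\<forall>w\<in>S. (y - p) \<bullet> w = 0" "p' \<in> S" "\<forall>w\<in>S. (y - p') \<bullet> w = 0"
    for y p p'
  proof -
    have "p - p' \<in> S" using that S by (simp add: subspace_diff)
    then have "(y - p') \<bullet> (p - p') - (y - p) \<bullet> (p - p') = 0" using that by simp
    then have "(p - p') \<bullet> (p - p') = 0" by (simp add: algebra_simps)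
    then show ?thesis by simp
  qed
  define P where "P y = (SOME p. p \<in> S \<and> (\<forall>w\<in>S. (y - p) \<bullet> w = 0))" for y
  have P: "P y \<in> S \<and> (\<forall>w\<in>S. (y - P y) \<bullet> w = 0)" for y
    unfolding P_def using someI_ex[OF ex[of y]] .
  have Peq: "P y = p" if "p \<in> S" "\<forall>w\<in>S. (y - p) \<bullet> w = 0" for y p
    using uniq[OF _ _ that] P by blast
  have "linear P"
  proof (rule linearI)
    show "P (a + b) = P a + P b" for a b
      using P[of a] P[of b] S
      by (intro Peq) (auto simp: subspace_add algebra_simps)
    show "P (r *\<^sub>R a) = r *\<^sub>R P a" for r a
      using P[of a] S
      by (intro Peq) (auto simp: subspace_scale algebra_simps)
  qed
  moreover have "P s = s" if "s \<in> S" for s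
    using that by (intro Peq) auto
  moreover have "P y \<bullet> z = y \<bullet> P z" for y z
  proof -
    have "(z - P z) \<bullet> P y = 0" "(y - P y) \<bullet> P z = 0" using P[of z] P[of y] by auto
    then show ?thesis
      using inner_commute[of "P y" z] inner_commute[of "P z" "P y"] by (simp add: inner_diff_left)
  qed
  ultimately show ?thesis using P that by blast
qed

abbreviation moore_penrose :: "real^'m^'m \<Rightarrow> real^'m^'m \<Rightarrow> bool" where
  "moore_penrose B X \<equiv> B ** X ** B = B \<and> X ** B ** X = X \<and>
     transpose (B ** X) = B ** X \<and> transpose (X ** B) = X ** B"

lemma moore_penrose_unique:
  fixes B X Y :: "real^'m^'m"
  assumes X: "moore_penrose B X" and Y: "moore_penrose B Y"
  shows "X = Y"
proof -
  have "X = X ** (B ** X)" using X by (simp add: matrix_mul_assoc)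
  also have "\<dots> = X ** (transpose X ** transpose B)" using X by (metis matrix_transpose_mul)
  also have "\<dots> = X ** (transpose X ** transpose (B ** Y ** B))" using Y by simp
  also have "\<dots> = X ** (transpose (B ** X)) ** (transpose (B ** Y))"
    by (simp add: matrix_transpose_mul matrix_mul_assoc)
  also have "\<dots> = X ** B ** Y" using X Y by (metis matrix_mul_assoc)
  finally have XY: "X = X ** B ** Y" .
  have "Y = (Y ** B) ** Y" using Y by simp
  also have "\<dots> = transpose B ** transpose Y ** Y" using Y by (metis matrix_transpose_mul)
  also have "\<dots> = transpose (B ** X ** B) ** transpose Y ** Y" using X by simp
  also have "\<dots> = transpose (X ** B) ** transpose (Y ** B) ** Y"
    by (simp add: matrix_transpose_mul matrix_mul_assoc)
  also have "\<dots> = X ** B ** Y" using X Y by (metis matrix_mul_assoc)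
  finally show ?thesis using XY by simp
qed

lemma symmetric_matrix_kernel_range:
  fixes B :: "real^'m^'m"
  assumes sym: "transpose B = B"
  shows "(\<And>w. w \<in> range ((*v) B) \<Longrightarrow> v \<bullet> w = 0) \<Longrightarrow> B *v v = 0"
    and "u \<in> range ((*v) B) \<Longrightarrow> v \<in> range ((*v) B) \<Longrightarrow> B *v u = B *v v \<Longrightarrow> u = v"
proof -
  have adj: "(B *v u) \<bullet> v = u \<bullet> (B *v v)" for u v
    using inner_matrix_vector_transpose[of B u v] sym by simp
  show "B *v v = 0" if "\<And>w. w \<in> range ((*v) B) \<Longrightarrow> v \<bullet> w = 0"
  proof -
    have "(B *v v) \<bullet> (B *v v) = v \<bullet> (B *v (B *v v))" by (rule adj)
    also have "\<dots> = 0" using that by auto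
    finally show ?thesis by simp
  qed
  show "u = v" if u: "u \<in> range ((*v) B)" and v: "v \<in> range ((*v) B)" and eq: "B *v u = B *v v"
  proof -
    obtain a b where "u = B *v a" "v = B *v b" using u v by auto
    then have "u - v = B *v (a - b)" by (simp add: matrix_vector_mult_diff_distrib)
    then have "(u - v) \<bullet> (u - v) = (a - b) \<bullet> (B *v (u - v))" using adj[of "a - b" "u - v"] by simp
    also have "\<dots> = 0" using eq by (simp add: matrix_vector_mult_diff_distrib)
    finally show ?thesis by simp
  qed
qed

text \<open>The pseudo-inverse of a symmetric \<open>B\<close> is the inverse of \<open>B\<close> on its range, composed with
  the orthogonal projection onto that range.\<close>

lemma moore_penrose_exists_symmetric:
  fixes B :: "real^'m^'m"
  assumes sym: "transpose B = B"
  shows "\<exists>X. moore_penrose B X"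
proof -
  define S where "S = range ((*v) B)"
  have "subspace S" unfolding S_def by (rule linear_subspace_image) auto
  then obtain P where P: "linear P" "\<And>y. P y \<in> S" "\<And>y w. w \<in> S \<Longrightarrow> (y - P y) \<bullet> w = 0"
    and PS: "\<And>s. s \<in> S \<Longrightarrow> P s = s" and Psa: "\<And>y z. P y \<bullet> z = y \<bullet> P z"
    using orthogonal_projection_exists by blast
  note kernel = symmetric_matrix_kernel_range[OF sym, folded S_def]
  have BP: "B *v (P v) = B *v v" for v
    using kernel(1)[of "v - P v"] P(3) by (simp add: matrix_vector_mult_diff_distrib)
  define X where "X y = P (SOME w. B *v w = P y)" for y
  have X: "X y \<in> S \<and> B *v X y = P y" for y
  proof -
    have "\<exists>w. B *v w = P y" using P(2)[of y] unfolding S_def by auto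
    then have "B *v (SOME w. B *v w = P y) = P y" by (rule someI_ex)
    then show ?thesis unfolding X_def using BP P(2) by simp
  qed
  have Xeq: "X y = s" if "s \<in> S" "B *v s = P y" for y s
    using kernel(2)[of "X y" s] X that by auto
  have "linear X"
  proof (rule linearI)
    show "X (a + b) = X a + X b" for a b
      using X[of a] X[of b] \<open>subspace S\<close> P(1)
      by (intro Xeq) (auto simp: subspace_add linear_add matrix_vector_right_distrib)
    show "X (r *\<^sub>R a) = r *\<^sub>R X a" for r a
      using X[of a] \<open>subspace S\<close> P(1)
      by (intro Xeq) (auto simp: subspace_scale linear_scale matrix_vector_mult_scaleR)
  qed
  then have Xm: "matrix X *v y = X y" for y by (simp add: matrix_works)
  have XBP: "X (B *v v) = P v" for v
    using BP PS P(2) by (intro Xeq) (auto simp: S_def)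
  have "B ** matrix X ** B = B"
    using X PS unfolding matrix_eq S_def by (auto simp: matrix_vector_mul_assoc[symmetric] Xm)
  moreover have "matrix X ** B ** matrix X = matrix X"
  proof -
    have "X (B *v X y) = X y" for y
      using X PS P(2) by (intro Xeq) auto
    then show ?thesis unfolding matrix_eq by (simp add: matrix_vector_mul_assoc[symmetric] Xm)
  qed
  moreover have "transpose (B ** matrix X) = B ** matrix X"
    by (rule matrix_self_adjoint_imp_symmetric) (simp add: matrix_vector_mul_assoc[symmetric] Xm X Psa)
  moreover have "transpose (matrix X ** B) = matrix X ** B"
    by (rule matrix_self_adjoint_imp_symmetric) (simp add: matrix_vector_mul_assoc[symmetric] Xm XBP Psa)
  ultimately show ?thesis by blast
qed

lemma moore_penrose_pinv_symmetric:
  assumes "transpose B = B"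
  shows "moore_penrose B (pinv B)"
proof -
  obtain X where "moore_penrose B X" using moore_penrose_exists_symmetric[OF assms] by blast
  then have "\<exists>!X. moore_penrose B X" using moore_penrose_unique by blast
  then show ?thesis unfolding pinv_def by (rule theI')
qed

lemma inner_compressed_matrix:
  fixes A :: "real^'n^'n" and D :: "real^'m^'n"
  shows "u \<bullet> ((transpose D ** A ** D) *v v) = (D *v u) \<bullet> (A *v (D *v v))"
  by (simp add: matrix_vector_mul_assoc[symmetric] inner_matrix_vector_transpose)

lemma transpose_compressed_matrix:
  fixes A :: "real^'n^'n" and D :: "real^'m^'n"
  shows "transpose A = A \<Longrightarrow> transpose (transpose D ** A ** D) = transpose D ** A ** D"
  by (simp add: matrix_transpose_mul matrix_mul_assoc)

text \<open>The pseudo-inverse step solves the compressed normal equations: although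
  \<open>D\<^sup>T A D\<close> may be singular, \<open>D\<^sup>T g\<close> lies in its range, because the part of \<open>D\<^sup>T g\<close>
  orthogonal to that range is annihilated by \<open>D\<close>.\<close>

lemma pinv_solves_compressed:
  fixes A :: "real^'n^'n" and D :: "real^'m^'n"
  defines "B \<equiv> transpose D ** A ** D"
  assumes symA: "transpose A = A" and posdef: "\<And>d. d \<noteq> 0 \<Longrightarrow> 0 < d \<bullet> (A *v d)"
  shows "B *v (pinv B *v (transpose D *v g)) = transpose D *v g"
proof -
  define w where "w = transpose D *v g"
  define X where "X = pinv B"
  have P: "B ** X ** B = B" "transpose (B ** X) = B ** X"
    using moore_penrose_pinv_symmetric[OF transpose_compressed_matrix[OF symA]]
    unfolding X_def B_def by auto
  have BXsa: "((B ** X) *v u) \<bullet> v = u \<bullet> ((B ** X) *v v)" for u v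
    using inner_matrix_vector_transpose[of "B ** X" u v] P(2) by simp
  have BXB: "(B ** X) *v (B *v u) = B *v u" for u
    using P(1) by (metis matrix_vector_mul_assoc)
  define r where "r = w - (B ** X) *v w"
  have "r \<bullet> (B *v r) = 0"
    using BXsa[of w "B *v r"] by (simp add: r_def inner_diff_left BXB)
  then have Dr: "D *v r = 0"
    using posdef[of "D *v r"] inner_compressed_matrix[of r D A r] by (auto simp: B_def)
  have BXr: "(B ** X) *v r = 0"
    using BXB[of "X *v w"] by (simp add: r_def matrix_vector_mult_diff_distrib matrix_vector_mul_assoc)
  have "r \<bullet> r = r \<bullet> w - r \<bullet> ((B ** X) *v w)"
    by (simp add: r_def inner_diff_right)
  also have "r \<bullet> w = (D *v r) \<bullet> g"
    unfolding w_def by (rule inner_matrix_vector_transpose[symmetric])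
  also have "r \<bullet> ((B ** X) *v w) = ((B ** X) *v r) \<bullet> w"
    by (simp add: BXsa)
  finally have "r = 0" using Dr BXr by simp
  then show ?thesis by (simp add: r_def w_def X_def matrix_vector_mul_assoc)
qed

lemma compressed_quadratic_minimizer:
  fixes A :: "real^'n^'n" and D :: "real^'m^'n"
  assumes symA: "transpose A = A" and psd: "\<And>d. 0 \<le> d \<bullet> (A *v d)"
    and normal: "(transpose D ** A ** D) *v \<Delta> = - (transpose D *v g)"
  shows "g \<bullet> (D *v \<Delta>) = - ((D *v \<Delta>) \<bullet> (A *v (D *v \<Delta>)))"
    and "g \<bullet> (D *v \<Delta>) + 1/2 * ((D *v \<Delta>) \<bullet> (A *v (D *v \<Delta>)))
           \<le> g \<bullet> (D *v v) + 1/2 * ((D *v v) \<bullet> (A *v (D *v v)))"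
proof -
  have gD: "g \<bullet> (D *v u) = - ((D *v u) \<bullet> (A *v (D *v \<Delta>)))" for u
  proof -
    have "g \<bullet> (D *v u) = (D *v u) \<bullet> g" by (rule inner_commute)
    also have "\<dots> = u \<bullet> (transpose D *v g)" by (rule inner_matrix_vector_transpose)
    also have "\<dots> = - (u \<bullet> ((transpose D ** A ** D) *v \<Delta>))" by (simp add: normal)
    finally show ?thesis by (simp only: inner_compressed_matrix)
  qed
  show "g \<bullet> (D *v \<Delta>) = - ((D *v \<Delta>) \<bullet> (A *v (D *v \<Delta>)))" by (rule gD)
  have Asa: "(A *v u) \<bullet> v = u \<bullet> (A *v v)" for u v
    using inner_matrix_vector_transpose[of A u v] symA by simp
  have "0 \<le> (D *v v - D *v \<Delta>) \<bullet> (A *v (D *v v - D *v \<Delta>))" by (rule psd)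
  also have "\<dots> = (D *v v) \<bullet> (A *v (D *v v)) - 2 * ((D *v v) \<bullet> (A *v (D *v \<Delta>)))
      + (D *v \<Delta>) \<bullet> (A *v (D *v \<Delta>))"
    using Asa[of "D *v \<Delta>" "D *v v"] inner_commute[of "D *v v" "A *v (D *v \<Delta>)"]
    by (simp add: matrix_vector_mult_diff_distrib inner_diff_right inner_diff_left)
  finally show "g \<bullet> (D *v \<Delta>) + 1/2 * ((D *v \<Delta>) \<bullet> (A *v (D *v \<Delta>)))
           \<le> g \<bullet> (D *v v) + 1/2 * ((D *v v) \<bullet> (A *v (D *v v)))"
    using gD[of v] gD[of \<Delta>] by simp
qed

section \<open>Gradients and half-quadratic potentials\<close>

lemma grad_eqI:
  assumes "GDERIV f x :> D"
  shows "grad f x = D"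
proof -
  have "D' = D" if "GDERIV f x :> D'" for D'
  proof -
    have "(\<lambda>h. h \<bullet> D') = (\<lambda>h. h \<bullet> D)"
      using has_derivative_unique that assms unfolding gderiv_def by blast
    then have "(D' - D) \<bullet> D' = (D' - D) \<bullet> D" by (rule fun_cong)
    then have "(D' - D) \<bullet> (D' - D) = 0" by (simp add: inner_diff_right)
    then show ?thesis by simp
  qed
  then show ?thesis unfolding grad_def by (rule the_equality[where P="\<lambda>D. GDERIV f x :> D", OF assms])
qed

lemma has_real_derivative_along_line:
  fixes f :: "'a::real_inner \<Rightarrow> real"
  assumes "GDERIV f (z + t *\<^sub>R e) :> g"
  shows "((\<lambda>t. f (z + t *\<^sub>R e)) has_real_derivative (g \<bullet> e)) (at t)"
proof -
  have "((\<lambda>t. z + t *\<^sub>R e) has_derivative (\<lambda>s. s *\<^sub>R e)) (at t)"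
    by (auto intro!: derivative_eq_intros)
  from has_derivative_compose[OF this assms[unfolded gderiv_def]]
  have "((\<lambda>t. f (z + t *\<^sub>R e)) has_derivative (\<lambda>s. (s *\<^sub>R e) \<bullet> g)) (at t)" by simp
  then show ?thesis unfolding has_field_derivative_def
    by (rule has_derivative_eq_rhs) (auto simp: fun_eq_iff inner_commute)
qed

lemma lipschitz_gradient_upper_bound:
  fixes f :: "'a::real_inner \<Rightarrow> real"
  assumes G: "\<And>z. GDERIV f z :> g z"
    and Lip: "\<And>z w. norm (g z - g w) \<le> L * norm (z - w)"
  shows "f (z + e) \<le> f z + g z \<bullet> e + L / 2 * (norm e)\<^sup>2"
proof -
  define h where "h t = f (z + t *\<^sub>R e) - t * (g z \<bullet> e) - L / 2 * t\<^sup>2 * (norm e)\<^sup>2" for t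
  have dh: "(h has_real_derivative (g (z + t *\<^sub>R e) \<bullet> e - g z \<bullet> e - L * t * (norm e)\<^sup>2)) (at t)" for t
    unfolding h_def
    by (auto intro!: derivative_eq_intros has_real_derivative_along_line G simp: power2_eq_square)
  have neg: "g (z + t *\<^sub>R e) \<bullet> e - g z \<bullet> e - L * t * (norm e)\<^sup>2 \<le> 0" if "0 \<le> t" for t
  proof -
    have "g (z + t *\<^sub>R e) \<bullet> e - g z \<bullet> e = (g (z + t *\<^sub>R e) - g z) \<bullet> e" by (simp add: inner_diff_left)
    also have "\<dots> \<le> norm (g (z + t *\<^sub>R e) - g z) * norm e" by (rule norm_cauchy_schwarz)
    also have "\<dots> \<le> L * norm (t *\<^sub>R e) * norm e"
      using Lip[of "z + t *\<^sub>R e" z] by (simp add: mult_right_mono)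
    also have "\<dots> = L * t * (norm e)\<^sup>2" using that by (simp add: power2_eq_square)
    finally show ?thesis by simp
  qed
  have "h 1 \<le> h 0"
  proof (rule DERIV_nonpos_imp_nonincreasing[of 0 1 h])
    show "\<exists>y. (h has_real_derivative y) (at t) \<and> y \<le> 0" if "0 \<le> t" for t
      using dh neg that by blast
  qed simp
  then show ?thesis by (simp add: h_def)
qed

lemma has_gradient_zero_if_quadratic_growth:
  fixes f :: "'a::real_inner \<Rightarrow> real"
  assumes growth: "\<And>y. \<bar>f y - f x\<bar> \<le> C * (norm (y - x))\<^sup>2"
  shows "GDERIV f x :> 0"
proof -
  have "((\<lambda>y. norm (f y - f x - (y - x) \<bullet> 0) / norm (y - x)) \<longlongrightarrow> 0) (at x)"
  proof (rule Lim_null_comparison)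
    show "\<forall>\<^sub>F y in at x. norm (norm (f y - f x - (y - x) \<bullet> 0) / norm (y - x)) \<le> C * norm (y - x)"
    proof (rule always_eventually, rule allI)
      fix y
      show "norm (norm (f y - f x - (y - x) \<bullet> 0) / norm (y - x)) \<le> C * norm (y - x)"
      proof (cases "y = x")
        case False
        then show ?thesis using growth[of y] by (simp add: divide_simps power2_eq_square mult.assoc)
      qed simp
    qed
    have "((\<lambda>y. y - x) \<longlongrightarrow> 0) (at x)"
      using tendsto_diff[OF tendsto_ident_at tendsto_const, of x x] by simp
    then show "((\<lambda>y. C * norm (y - x)) \<longlongrightarrow> 0) (at x)"
      by (intro tendsto_mult_right_zero tendsto_norm_zero)
  qed
  then show ?thesis unfolding gderiv_def has_derivative_iff_norm by simp
qed

lemma gradient_zero_if_quadratic_upper_bound: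
  fixes F :: "'a::real_inner \<Rightarrow> real"
  assumes grad: "GDERIV F xt :> g" and upper: "\<And>y. F y \<le> F xt + C * (norm (y - xt))\<^sup>2"
  shows "g = 0"
proof -
  have "((\<lambda>t. F (xt + t *\<^sub>R g)) has_real_derivative (g \<bullet> g)) (at 0)"
    using has_real_derivative_along_line[of F xt 0 g g] grad by simp
  then have quotient: "((\<lambda>t. (F (xt + t *\<^sub>R g) - F xt) / t) \<longlongrightarrow> g \<bullet> g) (at_right 0)"
    unfolding has_field_derivative_iff by (simp add: filterlim_at_split)
  have bound: "((\<lambda>t. C * t * (norm g)\<^sup>2) \<longlongrightarrow> 0) (at_right 0)"
    by (auto intro!: tendsto_eq_intros)
  have "(F (xt + t *\<^sub>R g) - F xt) / t \<le> C * t * (norm g)\<^sup>2" if "0 < t" for t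
    using upper[of "xt + t *\<^sub>R g"] that by (simp add: divide_simps power2_eq_square mult_ac)
  then have "eventually (\<lambda>t. (F (xt + t *\<^sub>R g) - F xt) / t \<le> C * t * (norm g)\<^sup>2) (at_right 0)"
    unfolding eventually_at_right_field by (intro exI[of _ 1]) auto
  then have "g \<bullet> g \<le> 0" by (rule tendsto_le[OF trivial_limit_at_right_real bound quotient])
  then show ?thesis using inner_gt_zero_iff[of g] by linarith
qed

text \<open>Hypotheses (A3ii)--(A3iv) on a single \<open>f = \<psi> s \<delta>\<close>, with \<open>wb\<close> in the role of \<open>\<omega>bar s\<close>.\<close>

locale sqrt_concave_potential =
  fixes f :: "real \<Rightarrow> real" and wb :: real
  assumes differentiable: "\<And>t. f differentiable (at t)"
    and concave_sqrt: "concave_on {0..} (\<lambda>t. f (sqrt t))"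
    and deriv_bounds: "\<And>t. t > 0 \<Longrightarrow> 0 \<le> deriv f t \<and> deriv f t \<le> wb * t"
    and deriv_ratio_limit: "\<exists>l. ((\<lambda>t. deriv f t / t) \<longlongrightarrow> l) (at 0)"
begin

lemma has_real_derivative: "(f has_real_derivative deriv f t) (at t)"
  using differentiable DERIV_deriv_iff_real_differentiable by blast

lemma omega_at_right_zero: "((\<lambda>t. deriv f t / t) \<longlongrightarrow> omega f 0) (at_right 0)"
proof -
  obtain l where l: "((\<lambda>t. deriv f t / t) \<longlongrightarrow> l) (at 0)" using deriv_ratio_limit by blast
  then have "omega f 0 = l" unfolding omega_def by (simp add: tendsto_Lim)
  then show ?thesis using l by (simp add: filterlim_at_split)
qed

lemma omega_bounds:
  assumes "t \<ge> 0"
  shows "0 \<le> omega f t \<and> omega f t \<le> wb"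
proof (cases "t = 0")
  case True
  have "eventually (\<lambda>s. 0 \<le> deriv f s / s \<and> deriv f s / s \<le> wb) (at_right 0)"
    unfolding eventually_at_right_field
    using deriv_bounds by (intro exI[of _ 1]) (auto simp: divide_simps mult.commute)
  then have "0 \<le> omega f 0" "omega f 0 \<le> wb"
    by (auto intro: tendsto_lowerbound[OF omega_at_right_zero] tendsto_upperbound[OF omega_at_right_zero]
        elim: eventually_mono)
  then show ?thesis using True by simp
next
  case False
  then show ?thesis using assms deriv_bounds[of t] by (auto simp: omega_def divide_simps mult.commute)
qed

lemma curvature_bound_nonneg: "wb \<ge> 0"
  using omega_bounds[of 0] by simp

text \<open>The tangent of the concave \<open>f \<circ> sqrt\<close> at \<open>t0\<^sup>2\<close>, read in the variable \<open>t\<^sup>2\<close>: this is the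
  half-quadratic majorant behind the MM scheme.\<close>

lemma tangent_parabola_pos:
  assumes "t0 > 0" "t \<ge> 0"
  shows "f t \<le> f t0 + omega f t0 / 2 * (t\<^sup>2 - t0\<^sup>2)"
proof -
  have cv: "convex_on {0..} (\<lambda>x. - f (sqrt x))" using concave_sqrt by (simp add: concave_on_def)
  have tangent: "((\<lambda>x. - f (sqrt x)) has_field_derivative - (deriv f t0 * (inverse (sqrt (t0\<^sup>2)) / 2)))
      (at (t0\<^sup>2) within {0..})"
    apply (rule has_field_derivative_at_within)
    apply (rule DERIV_minus)
    apply (rule DERIV_chain2[OF _ DERIV_real_sqrt])
    using has_real_derivative assms by auto
  have "- f (sqrt (t\<^sup>2)) - - f (sqrt (t0\<^sup>2)) \<ge> - (deriv f t0 * (inverse (sqrt (t0\<^sup>2)) / 2)) * (t\<^sup>2 - t0\<^sup>2)"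
    by (rule convex_on_imp_above_tangent[OF cv _ _ _ tangent]) (use assms in auto)
  then show ?thesis using assms by (simp add: omega_def field_simps)
qed

lemma tangent_parabola:
  assumes "t0 \<ge> 0" "t \<ge> 0"
  shows "f t \<le> f t0 + omega f t0 / 2 * (t\<^sup>2 - t0\<^sup>2)"
proof (cases "t0 = 0")
  case True
  have "(f \<longlongrightarrow> f 0) (at_right 0)"
    using has_real_derivative DERIV_isCont continuous_within_subset
    by (metis continuous_within subset_UNIV)
  then have "((\<lambda>s. f s + (deriv f s / s) / 2 * (t\<^sup>2 - s\<^sup>2)) \<longlongrightarrow> f 0 + omega f 0 / 2 * (t\<^sup>2 - 0\<^sup>2))
      (at_right 0)"
    by (intro tendsto_intros omega_at_right_zero) simp_all
  moreover have "eventually (\<lambda>s. f t \<le> f s + (deriv f s / s) / 2 * (t\<^sup>2 - s\<^sup>2)) (at_right 0)"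
    unfolding eventually_at_right_field
    using tangent_parabola_pos assms by (intro exI[of _ 1]) (auto simp: omega_def)
  ultimately have "f t \<le> f 0 + omega f 0 / 2 * (t\<^sup>2 - 0\<^sup>2)"
    by (rule tendsto_lowerbound) simp
  then show ?thesis using True by simp
qed (use tangent_parabola_pos assms in auto)

lemma mono_nonneg:
  assumes "0 \<le> a" "a \<le> b"
  shows "f a \<le> f b"
proof -
  have pos: "f a' \<le> f b" if "0 < a'" "a' \<le> b" for a'
    by (rule DERIV_nonneg_imp_nondecreasing[OF that(2)]) (use has_real_derivative deriv_bounds that in force)
  show ?thesis
  proof (cases "a = 0 \<and> b \<noteq> 0")
    case True
    have "(f \<longlongrightarrow> f 0) (at_right 0)"
      using has_real_derivative DERIV_isCont by (metis continuous_within subset_UNIV continuous_within_subset)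
    moreover have "eventually (\<lambda>s. f s \<le> f b) (at_right 0)"
      unfolding eventually_at_right_field using True assms by (intro exI[of _ b]) (auto intro!: pos)
    ultimately show ?thesis using True by (auto intro: tendsto_upperbound)
  qed (use pos assms in force)
qed


lemma norm_affine_majorant:
  fixes M :: "real^'n^'p" and c :: "real^'p"
  shows "f (norm (M *v (x + d) - c)) \<le> f (norm (M *v x - c))
     + (omega f (norm (M *v x - c)) *\<^sub>R (transpose M *v (M *v x - c))) \<bullet> d
     + omega f (norm (M *v x - c)) / 2 * (norm (M *v d))\<^sup>2"
proof -
  define r where "r = M *v x - c"
  have e: "M *v (x + d) - c = r + M *v d" by (simp add: r_def matrix_vector_right_distrib)
  have "(norm (r + M *v d))\<^sup>2 - (norm r)\<^sup>2 = 2 * (r \<bullet> (M *v d)) + (norm (M *v d))\<^sup>2"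
    by (simp add: power2_norm_eq_inner inner_add_left inner_add_right inner_commute)
  moreover have "r \<bullet> (M *v d) = (transpose M *v r) \<bullet> d"
    by (metis inner_matrix_vector_transpose inner_commute)
  ultimately show ?thesis
    using tangent_parabola[of "norm r" "norm (r + M *v d)"] unfolding e r_def[symmetric]
    by (simp add: algebra_simps)
qed

text \<open>\<open>f\<close> is nondecreasing and lies below its tangent parabola at \<open>0\<close>, so it grows at most
  quadratically away from a zero residual.\<close>

lemma has_gradient_at_zero_residual:
  fixes M :: "real^'n^'p" and c :: "real^'p"
  assumes zero: "M *v x = c"
  shows "GDERIV (\<lambda>x. f (norm (M *v x - c))) x :> 0"
proof -
  have "\<bar>f (norm (M *v y - c)) - f (norm (M *v x - c))\<bar>
      \<le> wb / 2 * (onorm ((*v) M))\<^sup>2 * (norm (y - x))\<^sup>2" for y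
  proof -
    have My: "M *v y - c = M *v (y - x)"
      using zero by (simp add: matrix_vector_mult_diff_distrib)
    have "0 \<le> f (norm (M *v (y - x))) - f 0"
      using mono_nonneg[of 0 "norm (M *v (y - x))"] by simp
    moreover have "f (norm (M *v (y - x))) - f 0 \<le> wb / 2 * (norm (M *v (y - x)))\<^sup>2"
      using tangent_parabola[of 0 "norm (M *v (y - x))"] omega_bounds[of 0]
        mult_right_mono[of "omega f 0" wb "(norm (M *v (y - x)))\<^sup>2"]
      by simp
    moreover have "wb / 2 * (norm (M *v (y - x)))\<^sup>2 \<le> wb / 2 * ((onorm ((*v) M))\<^sup>2 * (norm (y - x))\<^sup>2)"
      using curvature_bound_nonneg by (intro mult_left_mono power2_norm_matrix_vector_le) auto
    ultimately show ?thesis using zero My by (simp add: mult.assoc)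
  qed
  then show ?thesis by (rule has_gradient_zero_if_quadratic_growth)
qed

lemma has_gradient_norm_affine:
  fixes M :: "real^'n^'p" and c :: "real^'p"
  shows "GDERIV (\<lambda>x. f (norm (M *v x - c))) x :>
     omega f (norm (M *v x - c)) *\<^sub>R (transpose M *v (M *v x - c))"
proof (cases "M *v x - c = 0")
  case False
  define r where "r = M *v x - c"
  have affine: "((\<lambda>x. M *v x - c) has_derivative (\<lambda>k. M *v k)) (at x)"
    by (auto intro!: derivative_eq_intros linear_imp_has_derivative)
  have "((\<lambda>y. norm y) has_derivative (\<lambda>k. k \<bullet> sgn r)) (at (M *v x - c))"
    using GDERIV_norm[of r] False unfolding gderiv_def r_def by simp
  from has_derivative_compose[OF affine this]
  have "((\<lambda>x. norm (M *v x - c)) has_derivative (\<lambda>k. (M *v k) \<bullet> sgn r)) (at x)" .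
  then have "GDERIV (\<lambda>x. norm (M *v x - c)) x :> transpose M *v sgn r"
    unfolding gderiv_def
    by (rule has_derivative_eq_rhs) (auto simp: fun_eq_iff inner_matrix_vector_transpose)
  from GDERIV_DERIV_compose[OF this has_real_derivative]
  have "GDERIV (\<lambda>x. f (norm (M *v x - c))) x :> deriv f (norm r) *\<^sub>R (transpose M *v sgn r)"
    unfolding r_def by simp
  moreover have "deriv f (norm r) *\<^sub>R (transpose M *v sgn r) = omega f (norm r) *\<^sub>R (transpose M *v r)"
    using False unfolding r_def[symmetric]
    by (simp add: omega_def sgn_div_norm matrix_vector_mult_scaleR divide_inverse)
  ultimately show ?thesis unfolding r_def by simp
next
  case True
  then show ?thesis using has_gradient_at_zero_residual[where M=M and c=c and x=x] by simp
qed

end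

section \<open>Kurdyka--Lojasiewicz estimates for sequences\<close>

lemma powr_diff_lower_bound:
  fixes s t \<theta> :: real
  assumes "0 \<le> t" "t \<le> s" "0 < s" "0 \<le> \<theta>" "\<theta> < 1"
  shows "(1 - \<theta>) * (s - t) / s powr \<theta> \<le> s powr (1 - \<theta>) - t powr (1 - \<theta>)"
proof -
  define \<alpha> where "\<alpha> = 1 - \<theta>"
  have \<alpha>: "0 < \<alpha>" "\<alpha> \<le> 1" using assms unfolding \<alpha>_def by auto
  have "t powr \<alpha> \<le> (\<alpha> * (t / s) + (1 - \<alpha>)) * s powr \<alpha>"
  proof (cases "t = 0")
    case False
    then have "(t / s) powr \<alpha> * 1 powr (1 - \<alpha>) \<le> \<alpha> * (t / s) + (1 - \<alpha>) * 1"
      using \<alpha> assms by (intro Youngs_inequality_0) auto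
    moreover have "t powr \<alpha> = (t / s) powr \<alpha> * s powr \<alpha>"
      using False assms by (simp add: powr_divide)
    ultimately show ?thesis by (simp add: mult_right_mono)
  qed (use \<alpha> assms in simp)
  moreover have "s powr \<alpha> - (\<alpha> * (t / s) + (1 - \<alpha>)) * s powr \<alpha> = \<alpha> * (s - t) / s powr \<theta>"
    using assms by (simp add: \<alpha>_def powr_diff field_simps)
  ultimately show ?thesis unfolding \<alpha>_def by simp
qed

text \<open>One step of the Kurdyka--Lojasiewicz argument in scalar form: \<open>s\<close> and \<open>t\<close> are
  consecutive excess values, \<open>g\<close> the gradient norm, \<open>st\<close> the step length.\<close>

lemma kl_step_bound:
  fixes s t g a c \<kappa> \<theta> st :: real
  assumes "0 \<le> t" "t \<le> s" "a > 0" "\<kappa> > 0" "0 \<le> \<theta>" "\<theta> < 1" "c \<ge> 0"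
    and decrease: "a * g\<^sup>2 \<le> s - t" and KL: "\<kappa> * s powr \<theta> \<le> g"
    and step: "st \<le> c * sqrt (s - t)"
  shows "st \<le> c / ((1 - \<theta>) * \<kappa> * sqrt a) * (s powr (1 - \<theta>) - t powr (1 - \<theta>))"
proof (cases "s = t")
  case True then show ?thesis using assms by simp
next
  case False
  then have st: "t < s" "0 < s" using assms by auto
  have sth: "s powr \<theta> > 0" using st by simp
  have gpos: "g > 0" using assms(4) KL sth by (smt (verit) mult_pos_pos)
  have "g\<^sup>2 \<le> (s - t) / a" using assms(3) decrease by (simp add: field_simps)
  then have "g \<le> sqrt ((s - t) / a)" using gpos by (simp add: real_le_rsqrt)
  then have "g * sqrt a \<le> sqrt (s - t)"
    using gpos st assms(3) by (simp add: real_sqrt_divide field_simps)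
  from mult_right_mono[OF this real_sqrt_ge_zero[of "s - t"]]
  have "g * (sqrt a * sqrt (s - t)) \<le> s - t" using st by (simp add: mult.assoc)
  then have sq: "sqrt a * sqrt (s - t) \<le> (s - t) / g"
    using gpos by (simp add: field_simps)
  have kg: "\<kappa> * ((s - t) / g) \<le> (s - t) / s powr \<theta>"
  proof -
    have "\<kappa> / g \<le> 1 / s powr \<theta>" using KL sth gpos by (simp add: field_simps)
    from mult_left_mono[OF this, of "s - t"] show ?thesis
      using st mult.commute[of "s - t" \<kappa>] by simp
  qed
  have "(1 - \<theta>) * \<kappa> * (sqrt a * sqrt (s - t)) \<le> (1 - \<theta>) * (\<kappa> * ((s - t) / g))"
    using mult_left_mono[OF sq, of "(1 - \<theta>) * \<kappa>"] assms by (simp add: mult.assoc)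
  also have "\<dots> \<le> (1 - \<theta>) * ((s - t) / s powr \<theta>)"
    using kg assms by (intro mult_left_mono) auto
  also have "\<dots> \<le> s powr (1 - \<theta>) - t powr (1 - \<theta>)"
    using powr_diff_lower_bound assms st by simp
  finally have *: "(1 - \<theta>) * \<kappa> * sqrt a * sqrt (s - t) \<le> s powr (1 - \<theta>) - t powr (1 - \<theta>)"
    by (simp add: mult.assoc)
  have pos: "(1 - \<theta>) * \<kappa> * sqrt a > 0" using assms by simp
  have "st \<le> c / ((1 - \<theta>) * \<kappa> * sqrt a) * ((1 - \<theta>) * \<kappa> * sqrt a * sqrt (s - t))"
    using step pos assms(3,4,6) by simp
  also have "\<dots> \<le> c / ((1 - \<theta>) * \<kappa> * sqrt a) * (s powr (1 - \<theta>) - t powr (1 - \<theta>))"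
    using * pos assms(7) by (intro mult_left_mono) auto
  finally show ?thesis .
qed

lemma summable_steps_if_kl:
  fixes f g d :: "nat \<Rightarrow> real"
  assumes lim: "f \<longlonglongrightarrow> l" and above: "\<And>k. l \<le> f k"
    and a: "a > 0" and decrease: "\<And>k. a * (g k)\<^sup>2 \<le> f k - f (Suc k)"
    and c: "c \<ge> 0" and step: "\<And>k. d k \<le> c * sqrt (f k - f (Suc k))" and d: "\<And>k. 0 \<le> d k"
    and \<kappa>: "\<kappa> > 0" and \<theta>: "0 \<le> \<theta>" "\<theta> < 1"
    and KL: "\<And>k. k \<ge> K \<Longrightarrow> \<kappa> * (f k - l) powr \<theta> \<le> g k"
  shows "summable d"
proof -
  define \<phi> where "\<phi> k = (f k - l) powr (1 - \<theta>)" for k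
  define C where "C = c / ((1 - \<theta>) * \<kappa> * sqrt a)"
  have bound: "d k \<le> C * (\<phi> k - \<phi> (Suc k))" if "k \<ge> K" for k
    unfolding C_def \<phi>_def
  proof (rule kl_step_bound)
    have "0 \<le> a * (g k)\<^sup>2" using a by simp
    then show "0 \<le> f (Suc k) - l" "f (Suc k) - l \<le> f k - l"
      using above[of "Suc k"] decrease[of k] by auto
  qed (use a c \<kappa> \<theta> decrease step KL[OF that] in auto)
  have "\<phi> \<longlonglongrightarrow> 0"
    unfolding \<phi>_def using lim above \<theta>
    by (intro tendsto_zero_powrI) (auto simp: LIM_zero)
  then have "summable (\<lambda>k. C * (\<phi> k - \<phi> (Suc k)))"
    by (intro summable_mult telescope_summable')
  then show ?thesis
    by (rule summable_comparison_test'[where N=K]) (use bound d in simp)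
qed

lemma tendsto_zero_if_sufficient_decrease:
  fixes f :: "nat \<Rightarrow> real" and g :: "nat \<Rightarrow> 'a::real_normed_vector"
  assumes lim: "f \<longlonglongrightarrow> l" and a: "a > 0" and decrease: "\<And>k. a * (norm (g k))\<^sup>2 \<le> f k - f (Suc k)"
  shows "g \<longlonglongrightarrow> 0"
proof -
  have gap: "(\<lambda>k. (f k - f (Suc k)) / a) \<longlonglongrightarrow> 0"
    using tendsto_divide[OF tendsto_diff[OF lim LIMSEQ_Suc[OF lim]] tendsto_const, of a] a by simp
  have "(norm (g k))\<^sup>2 * a \<le> f k - f (Suc k)" for k
    using decrease[of k] by (simp only: mult.commute)
  then have "norm ((norm (g k))\<^sup>2) \<le> (f k - f (Suc k)) / a" for k
    by (simp add: pos_le_divide_eq[OF a])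
  then have "(\<lambda>k. (norm (g k))\<^sup>2) \<longlonglongrightarrow> 0"
    by (intro Lim_null_comparison[OF always_eventually gap] allI)
  from tendsto_real_sqrt[OF this] show ?thesis by (simp add: tendsto_norm_zero_iff)
qed

lemma convergent_if_summable_norm_diff:
  fixes x :: "nat \<Rightarrow> 'a::banach"
  assumes "summable (\<lambda>k. norm (x (Suc k) - x k))"
  shows "x \<longlonglongrightarrow> x 0 + (\<Sum>k. x (Suc k) - x k)"
proof -
  have "(\<lambda>n. \<Sum>k<n. x (Suc k) - x k) \<longlonglongrightarrow> (\<Sum>k. x (Suc k) - x k)"
    by (rule summable_LIMSEQ[OF summable_norm_cancel[OF assms]])
  then have "(\<lambda>n. x 0 + (\<Sum>k<n. x (Suc k) - x k)) \<longlonglongrightarrow> x 0 + (\<Sum>k. x (Suc k) - x k)"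
    by (intro tendsto_add tendsto_const)
  then show ?thesis by (simp add: sum_lessThan_telescope)
qed

lemma decreasing_values_at_cluster_point:
  fixes x :: "nat \<Rightarrow> 'a::heine_borel" and F :: "'a \<Rightarrow> real"
  assumes dec: "decseq (\<lambda>k. F (x k))" and bnd: "bounded (range x)" and cont: "continuous_on UNIV F"
  obtains xb where "(\<lambda>k. F (x k)) \<longlonglongrightarrow> F xb" "\<And>k. F xb \<le> F (x k)"
proof -
  obtain xb r where r: "strict_mono r" "(x \<circ> r) \<longlonglongrightarrow> xb"
    using bounded_imp_convergent_subsequence[OF bnd] by blast
  have sub: "(\<lambda>k. F (x (r k))) \<longlonglongrightarrow> F xb"
    using continuous_on_tendsto_compose[OF cont r(2)] by (simp add: comp_def)
  have lb: "F xb \<le> F (x k)" for k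
  proof -
    have "decseq (\<lambda>k. F (x (r k)))"
      using dec r(1) unfolding decseq_def by (simp add: strict_mono_mono monoD)
    then have "F xb \<le> F (x (r k))" using sub by (rule decseq_ge[of "\<lambda>k. F (x (r k))"])
    also have "\<dots> \<le> F (x k)" using dec seq_suble[OF r(1), of k] unfolding decseq_def by simp
    finally show ?thesis .
  qed
  obtain L where L: "(\<lambda>k. F (x k)) \<longlonglongrightarrow> L" using decseq_convergent[OF dec] lb by blast
  have "L = F xb" using LIMSEQ_unique[OF LIMSEQ_subseq_LIMSEQ[OF L r(1)]] sub by (simp add: comp_def)
  then show ?thesis using that L lb by blast
qed

section \<open>Subspace majorize--minimize iterations\<close>

lemma antimono_if_steps_decrease:
  fixes f :: "nat \<Rightarrow> 'a::order"
  assumes "\<And>j. j < J \<Longrightarrow> f (Suc j) \<le> f j" and "i \<le> j" "j \<le> J"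
  shows "f j \<le> f i"
  using assms(2,3)
proof (induction j rule: dec_induct)
  case (step j)
  then have "f (Suc j) \<le> f j" "f j \<le> f i" using assms(1) by simp_all
  then show ?case by (rule order_trans)
qed simp

lemma norm_diff_le_if_steps_decrease:
  fixes z :: "nat \<Rightarrow> 'a::real_normed_vector" and f :: "nat \<Rightarrow> real"
  assumes steps: "\<And>j. j < J \<Longrightarrow> c * (norm (z (Suc j) - z j))\<^sup>2 \<le> f j - f (Suc j)" and c: "c > 0"
  shows "norm (z J - z 0) \<le> J * sqrt ((f 0 - f J) / c)"
proof -
  have "f (Suc j) \<le> f j" if "j < J" for j
    using steps[OF that] c by (smt (verit) mult_nonneg_nonneg zero_le_power2)
  note mono = antimono_if_steps_decrease[of J f, OF this]
  have each: "norm (z (Suc j) - z j) \<le> sqrt ((f 0 - f J) / c)" if "j < J" for j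
  proof (rule real_le_rsqrt)
    have "c * (norm (z (Suc j) - z j))\<^sup>2 \<le> f 0 - f J"
      using steps[OF that] mono[of 0 j] mono[of "Suc j" J] that by simp
    then show "(norm (z (Suc j) - z j))\<^sup>2 \<le> (f 0 - f J) / c" using c by (simp add: field_simps)
  qed
  have "norm (z J - z 0) = norm (\<Sum>j<J. z (Suc j) - z j)" by (simp add: sum_lessThan_telescope)
  also have "\<dots> \<le> (\<Sum>j<J. norm (z (Suc j) - z j))" by (rule norm_sum)
  also have "\<dots> \<le> J * sqrt ((f 0 - f J) / c)"
    using sum_bounded_above[of "{..<J}" "\<lambda>j. norm (z (Suc j) - z j)"] each by simp
  finally show ?thesis .
qed

locale quadratic_majorant =
  fixes F :: "real^'n \<Rightarrow> real" and G :: "real^'n \<Rightarrow> real^'n" and A :: "real^'n \<Rightarrow> real^'n^'n"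
    and \<nu> \<nu>b :: real
  assumes majorant: "\<And>z d. F (z + d) \<le> F z + G z \<bullet> d + 1/2 * (d \<bullet> (A z *v d))"
    and symmetric: "\<And>z. transpose (A z) = A z"
    and curvature_lower_pos: "\<nu> > 0"
    and curvature_lower: "\<And>z d. \<nu> * (norm d)\<^sup>2 \<le> d \<bullet> (A z *v d)"
    and curvature_upper: "\<And>z d. d \<bullet> (A z *v d) \<le> \<nu>b * (norm d)\<^sup>2"
begin

lemma curvature_upper_pos: "\<nu>b > 0"
proof -
  obtain i :: 'n where True by blast
  have "(norm (axis i (1::real)))\<^sup>2 > 0" by simp
  moreover have "\<nu> * (norm (axis i (1::real)))\<^sup>2 \<le> \<nu>b * (norm (axis i (1::real)))\<^sup>2"
    using curvature_lower curvature_upper order_trans by blast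
  ultimately have "\<nu> \<le> \<nu>b" by (rule mult_right_le_imp_le[rotated])
  then show ?thesis using curvature_lower_pos by linarith
qed

lemma subspace_step:
  fixes D :: "real^'m^'n" and z :: "real^'n"
  defines "\<Delta> \<equiv> - (pinv (transpose D ** A z ** D) *v (transpose D *v G z))"
  shows "F (z + D *v \<Delta>) \<le> F z - \<nu> / 2 * (norm (D *v \<Delta>))\<^sup>2"
    and "F (z + D *v \<Delta>) \<le> F z + G z \<bullet> (D *v v) + 1/2 * ((D *v v) \<bullet> (A z *v (D *v v)))"
proof -
  have posdef: "0 < d \<bullet> (A z *v d)" if "d \<noteq> 0" for d
    using curvature_lower[of d z] curvature_lower_pos that by (smt (verit) mult_pos_pos zero_less_power2 zero_less_norm_iff)
  have psd: "0 \<le> d \<bullet> (A z *v d)" for d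
    using posdef[of d] by fastforce
  have normal: "(transpose D ** A z ** D) *v \<Delta> = - (transpose D *v G z)"
    using pinv_solves_compressed[OF symmetric posdef] by (simp add: \<Delta>_def vec.neg)
  note minimizer = compressed_quadratic_minimizer[OF symmetric psd normal]
  have step: "F (z + D *v \<Delta>) \<le> F z + G z \<bullet> (D *v \<Delta>) + 1/2 * ((D *v \<Delta>) \<bullet> (A z *v (D *v \<Delta>)))"
    by (rule majorant)
  then show "F (z + D *v \<Delta>) \<le> F z - \<nu> / 2 * (norm (D *v \<Delta>))\<^sup>2"
    using minimizer(1) curvature_lower[of "D *v \<Delta>" z] by simp
  show "F (z + D *v \<Delta>) \<le> F z + G z \<bullet> (D *v v) + 1/2 * ((D *v v) \<bullet> (A z *v (D *v v)))"
    using step minimizer(2)[of v] by simp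
qed

text \<open>A step along \<open>\<tau> d\<close> with \<open>\<tau> = \<gamma>\<^sub>0 / (\<nu>b \<gamma>\<^sub>1\<^sup>2)\<close>, the minimizer of the resulting scalar
  upper bound, certifies the sufficient decrease of the first inner step.\<close>

lemma first_step_sufficient_decrease:
  fixes D :: "real^'m^'n" and z :: "real^'n" and j1 :: 'm
  defines "\<Delta> \<equiv> - (pinv (transpose D ** A z ** D) *v (transpose D *v G z))"
  assumes descent: "G z \<bullet> column j1 D \<le> - \<gamma>0 * (norm (G z))\<^sup>2"
    and bounded: "norm (column j1 D) \<le> \<gamma>1 * norm (G z)"
    and \<gamma>: "\<gamma>0 > 0" "\<gamma>1 > 0"
  shows "F (z + D *v \<Delta>) \<le> F z - \<gamma>0\<^sup>2 / (2 * \<nu>b * \<gamma>1\<^sup>2) * (norm (G z))\<^sup>2"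
proof -
  define \<tau> where "\<tau> = \<gamma>0 / (\<nu>b * \<gamma>1\<^sup>2)"
  define d where "d = column j1 D"
  have \<tau>: "\<tau> > 0" using \<gamma> curvature_upper_pos by (simp add: \<tau>_def)
  have "D *v (\<tau> *\<^sub>R axis j1 1) = \<tau> *\<^sub>R d"
    by (simp add: d_def matrix_vector_mult_scaleR matrix_vector_mult_basis)
  then have "F (z + D *v \<Delta>) \<le> F z + G z \<bullet> (\<tau> *\<^sub>R d) + 1/2 * ((\<tau> *\<^sub>R d) \<bullet> (A z *v (\<tau> *\<^sub>R d)))"
    using subspace_step(2)[where D=D and z=z and v="\<tau> *\<^sub>R axis j1 1"] by (simp add: \<Delta>_def)
  also have "G z \<bullet> (\<tau> *\<^sub>R d) \<le> - \<tau> * \<gamma>0 * (norm (G z))\<^sup>2"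
    using mult_left_mono[OF descent, of \<tau>] \<tau> by (simp add: d_def)
  also have "(\<tau> *\<^sub>R d) \<bullet> (A z *v (\<tau> *\<^sub>R d)) \<le> \<nu>b * \<tau>\<^sup>2 * (\<gamma>1 * norm (G z))\<^sup>2"
  proof -
    have "(norm d)\<^sup>2 \<le> (\<gamma>1 * norm (G z))\<^sup>2"
      using bounded by (simp add: d_def power_mono)
    then have "\<nu>b * (norm (\<tau> *\<^sub>R d))\<^sup>2 \<le> \<nu>b * \<tau>\<^sup>2 * (\<gamma>1 * norm (G z))\<^sup>2"
      using curvature_upper_pos \<tau> by (simp add: power_mult_distrib mult_left_mono mult.assoc)
    then show ?thesis using curvature_upper[of "\<tau> *\<^sub>R d" z] by linarith
  qed
  also have "F z + - \<tau> * \<gamma>0 * (norm (G z))\<^sup>2 + 1/2 * (\<nu>b * \<tau>\<^sup>2 * (\<gamma>1 * norm (G z))\<^sup>2)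
      = F z - \<gamma>0\<^sup>2 / (2 * \<nu>b * \<gamma>1\<^sup>2) * (norm (G z))\<^sup>2"
    using curvature_upper_pos \<gamma> by (simp add: \<tau>_def field_simps power2_eq_square)
  finally show ?thesis by simp
qed

lemma inner_loop_bounds:
  fixes D :: "real^'m^'n" and u :: "nat \<Rightarrow> real^'m" and j1 :: 'm
  assumes u0: "u 0 = 0"
    and uj: "\<And>j. 1 \<le> j \<Longrightarrow> j \<le> J \<Longrightarrow> u j = u (j - 1)
         - pinv (transpose D ** A (z + D *v u (j - 1)) ** D) *v (transpose D *v G (z + D *v u (j - 1)))"
    and J: "J \<ge> 1"
    and descent: "G z \<bullet> column j1 D \<le> - \<gamma>0 * (norm (G z))\<^sup>2"
    and bounded: "norm (column j1 D) \<le> \<gamma>1 * norm (G z)"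
    and \<gamma>: "\<gamma>0 > 0" "\<gamma>1 > 0"
  shows "F (z + D *v u J) \<le> F z - \<gamma>0\<^sup>2 / (2 * \<nu>b * \<gamma>1\<^sup>2) * (norm (G z))\<^sup>2"
    and "norm (D *v u J) \<le> J * sqrt (2 / \<nu> * (F z - F (z + D *v u J)))"
proof -
  define w where "w j = z + D *v u j" for j
  have w_step: "w (Suc j) = w j + D *v - (pinv (transpose D ** A (w j) ** D) *v (transpose D *v G (w j)))"
    if "j < J" for j
    using uj[of "Suc j"] that by (simp add: w_def matrix_vector_mult_diff_distrib vec.neg)
  have decrease: "\<nu> / 2 * (norm (w (Suc j) - w j))\<^sup>2 \<le> F (w j) - F (w (Suc j))" if "j < J" for j
    using subspace_step(1)[where D=D and z="w j"] w_step[OF that] by simp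
  have "F (w (Suc j)) \<le> F (w j)" if "j < J" for j
  proof -
    have "0 \<le> \<nu> / 2 * (norm (w (Suc j) - w j))\<^sup>2" using curvature_lower_pos by simp
    then show ?thesis using decrease[OF that] by linarith
  qed
  from antimono_if_steps_decrease[of J "\<lambda>j. F (w j)", OF this] J
  have "F (w J) \<le> F (w 1)" by simp
  moreover have "F (w 1) \<le> F z - \<gamma>0\<^sup>2 / (2 * \<nu>b * \<gamma>1\<^sup>2) * (norm (G z))\<^sup>2"
    using first_step_sufficient_decrease[OF descent bounded \<gamma>] w_step[of 0] J by (simp add: w_def u0)
  ultimately show "F (z + D *v u J) \<le> F z - \<gamma>0\<^sup>2 / (2 * \<nu>b * \<gamma>1\<^sup>2) * (norm (G z))\<^sup>2"
    by (simp add: w_def)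
  have "norm (D *v u J) = norm (w J - w 0)" by (simp add: w_def u0)
  also have "\<dots> \<le> J * sqrt ((F (w 0) - F (w J)) / (\<nu> / 2))"
    using decrease curvature_lower_pos by (intro norm_diff_le_if_steps_decrease) auto
  also have "(F (w 0) - F (w J)) / (\<nu> / 2) = 2 / \<nu> * (F z - F (z + D *v u J))"
    by (simp add: w_def u0)
  finally show "norm (D *v u J) \<le> J * sqrt (2 / \<nu> * (F z - F (z + D *v u J)))" .
qed

end

locale quadratic_majorant_kl = quadratic_majorant +
  assumes has_gradient: "\<And>z. GDERIV F z :> G z"
    and continuous: "continuous_on UNIV F"
    and bounded_sublevel: "\<And>c. bounded {z. F z \<le> c}"
    and kl: "KL F"
begin

lemma kl_at_limit_value:
  assumes bnd: "bounded (range x)" and lim: "(\<lambda>k. F (x k)) \<longlonglongrightarrow> F xb"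
    and above: "\<And>k. F xb \<le> F (x k)"
  obtains \<kappa> \<theta> K where "\<kappa> > 0" "0 \<le> \<theta>" "\<theta> < 1"
    "\<And>k. k \<ge> K \<Longrightarrow> \<kappa> * (F (x k) - F xb) powr \<theta> \<le> norm (G (x k))"
proof -
  obtain R where R: "R > 0" "range x \<subseteq> ball xb R"
    using bounded_subset_ballD[OF bnd] by blast
  have "bounded (ball xb R) \<and> (\<exists>U. open U \<and> xb \<in> U \<and> U \<subseteq> ball xb R)"
    using R(1) by (auto intro!: exI[of _ "ball xb R"])
  from kl[unfolded KL_def, rule_format, OF this]
  obtain \<kappa> \<zeta> \<theta> where kl_xb: "\<kappa> > 0" "\<zeta> > 0" "0 \<le> \<theta>" "\<theta> < 1"
    "\<forall>z\<in>ball xb R. \<bar>F z - F xb\<bar> < \<zeta> \<longrightarrow> norm (grad F z) \<ge> \<kappa> * \<bar>F z - F xb\<bar> powr \<theta>"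
    by blast
  obtain K where K: "\<And>k. k \<ge> K \<Longrightarrow> F (x k) < F xb + \<zeta>"
    using order_tendstoD(2)[OF lim, of "F xb + \<zeta>"] kl_xb(2) by (auto simp: eventually_sequentially)
  have "\<kappa> * (F (x k) - F xb) powr \<theta> \<le> norm (G (x k))" if "k \<ge> K" for k
  proof -
    have "x k \<in> ball xb R" using R(2) rangeI by blast
    moreover have "\<bar>F (x k) - F xb\<bar> < \<zeta>" using above[of k] K[OF that] by simp
    ultimately have "\<kappa> * \<bar>F (x k) - F xb\<bar> powr \<theta> \<le> norm (grad F (x k))"
      using kl_xb(5) by blast
    then show ?thesis using above[of k] by (simp add: grad_eqI[OF has_gradient])
  qed
  then show ?thesis using that kl_xb by blast
qed

lemma limit_is_critical:
  assumes lim: "x \<longlonglongrightarrow> xt" and grad_lim: "(\<lambda>k. G (x k)) \<longlonglongrightarrow> 0"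
  shows "G xt = 0"
proof (rule gradient_zero_if_quadratic_upper_bound[OF has_gradient])
  fix y
  have "F y \<le> F (x k) + G (x k) \<bullet> (y - x k) + \<nu>b / 2 * (norm (y - x k))\<^sup>2" for k
    using majorant[of "x k" "y - x k"] curvature_upper[of "y - x k" "x k"] by simp
  moreover have "(\<lambda>k. F (x k) + G (x k) \<bullet> (y - x k) + \<nu>b / 2 * (norm (y - x k))\<^sup>2)
      \<longlonglongrightarrow> F xt + 0 \<bullet> (y - xt) + \<nu>b / 2 * (norm (y - xt))\<^sup>2"
    by (intro tendsto_intros continuous_on_tendsto_compose[OF continuous lim] grad_lim lim) simp_all
  ultimately show "F y \<le> F xt + \<nu>b / 2 * (norm (y - xt))\<^sup>2"
    using LIMSEQ_le_const by fastforce
qed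

theorem subspace_iteration_converges:
  fixes D :: "nat \<Rightarrow> real^'m^_" and j1 :: 'm and J :: nat
  assumes J: "J \<ge> 1" and u0: "\<And>k. u k 0 = 0"
    and uj: "\<And>k j. 1 \<le> j \<Longrightarrow> j \<le> J \<Longrightarrow> u k j = u k (j - 1)
         - pinv (transpose (D k) ** A (x k + D k *v u k (j - 1)) ** D k)
             *v (transpose (D k) *v G (x k + D k *v u k (j - 1)))"
    and xstep: "\<And>k. x (Suc k) = x k + D k *v u k J"
    and gradient_related: "\<exists>\<gamma>0>0. \<exists>\<gamma>1>0. \<forall>k.
       G (x k) \<bullet> column j1 (D k) \<le> - \<gamma>0 * (norm (G (x k)))\<^sup>2 \<and>
       norm (column j1 (D k)) \<le> \<gamma>1 * norm (G (x k))"
  shows "\<exists>xt. x \<longlonglongrightarrow> xt \<and> G xt = 0 \<and> summable (\<lambda>k. norm (x (Suc k) - x k))"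
proof -
  obtain \<gamma>0 \<gamma>1 where \<gamma>: "\<gamma>0 > 0" "\<gamma>1 > 0"
    and descent: "\<And>k. G (x k) \<bullet> column j1 (D k) \<le> - \<gamma>0 * (norm (G (x k)))\<^sup>2"
    and bounded: "\<And>k. norm (column j1 (D k)) \<le> \<gamma>1 * norm (G (x k))"
    using gradient_related by blast
  define a where "a = \<gamma>0\<^sup>2 / (2 * \<nu>b * \<gamma>1\<^sup>2)"
  define c where "c = real J * sqrt (2 / \<nu>)"
  have a: "a > 0" using \<gamma> curvature_upper_pos by (simp add: a_def)
  have decrease: "a * (norm (G (x k)))\<^sup>2 \<le> F (x k) - F (x (Suc k))"
    and "norm (x (Suc k) - x k) \<le> J * sqrt (2 / \<nu> * (F (x k) - F (x (Suc k))))" for k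
    using inner_loop_bounds[where u="u k" and D="D k" and z="x k", OF u0 uj J descent bounded \<gamma>]
    by (simp_all add: xstep a_def)
  then have step: "norm (x (Suc k) - x k) \<le> c * sqrt (F (x k) - F (x (Suc k)))" for k
    by (simp only: c_def real_sqrt_mult mult.assoc)
  have "F (x (Suc k)) \<le> F (x k)" for k
  proof -
    have "0 \<le> a * (norm (G (x k)))\<^sup>2" using a by simp
    then show ?thesis using decrease[of k] by linarith
  qed
  then have dec: "decseq (\<lambda>k. F (x k))" by (rule decseq_SucI)
  then have "range x \<subseteq> {z. F z \<le> F (x 0)}" by (auto simp: decseq_def)
  then have bnd: "bounded (range x)" by (rule bounded_subset[OF bounded_sublevel])
  obtain xb where lim: "(\<lambda>k. F (x k)) \<longlonglongrightarrow> F xb" and above: "\<And>k. F xb \<le> F (x k)"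
    using decreasing_values_at_cluster_point[OF dec bnd continuous] by blast
  obtain \<kappa> \<theta> K where kl_x: "\<kappa> > 0" "0 \<le> \<theta>" "\<theta> < 1"
    "\<And>k. k \<ge> K \<Longrightarrow> \<kappa> * (F (x k) - F xb) powr \<theta> \<le> norm (G (x k))"
    using kl_at_limit_value[OF bnd lim above] by blast
  have "c \<ge> 0" using curvature_lower_pos by (simp add: c_def)
  from summable_steps_if_kl[where f="\<lambda>k. F (x k)" and g="\<lambda>k. norm (G (x k))"
      and d="\<lambda>k. norm (x (Suc k) - x k)", OF lim above a decrease this step norm_ge_zero kl_x]
  have finite_length: "summable (\<lambda>k. norm (x (Suc k) - x k))" .
  define xt where "xt = x 0 + (\<Sum>k. x (Suc k) - x k)"
  have x_lim: "x \<longlonglongrightarrow> xt"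
    unfolding xt_def by (rule convergent_if_summable_norm_diff[OF finite_length])
  have "(\<lambda>k. G (x k)) \<longlonglongrightarrow> 0"
    by (rule tendsto_zero_if_sufficient_decrease[OF lim a decrease])
  with x_lim have "G xt = 0" by (rule limit_is_critical)
  with x_lim finite_length show ?thesis by blast
qed

end

section \<open>The objective \<open>F\<^sub>\<delta>\<close>\<close>

lemma coercive_bounded_below:
  fixes f :: "'a::{real_normed_vector, heine_borel} \<Rightarrow> real"
  assumes "continuous_on UNIV f" "coercive f"
  shows "\<exists>m. \<forall>z. m \<le> f z"
proof -
  have "eventually (\<lambda>z. 0 \<le> f z) at_infinity"
    using assms(2) unfolding coercive_def filterlim_at_top by blast
  then obtain b where far: "\<And>z. b \<le> norm z \<Longrightarrow> 0 \<le> f z" unfolding eventually_at_infinity by blast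
  have "cball 0 (max b 0) \<noteq> {}" by simp
  from continuous_attains_inf[OF compact_cball this continuous_on_subset[OF assms(1) subset_UNIV]]
  obtain z0 where z0: "\<And>z. z \<in> cball 0 (max b 0) \<Longrightarrow> f z0 \<le> f z" by blast
  have "min 0 (f z0) \<le> f z" for z
  proof (cases "b \<le> norm z")
    case False
    then have "f z0 \<le> f z" using z0[of z] by simp
    then show ?thesis by simp
  qed (use far[of z] in simp)
  then show ?thesis by blast
qed

lemma coercive_not_affinely_bounded:
  fixes f :: "'a::euclidean_space \<Rightarrow> real"
  assumes "coercive f"
  shows "\<not> (\<forall>e. f e \<le> b + g \<bullet> e)"
proof
  assume affine: "\<forall>e. f e \<le> b + g \<bullet> e"
  obtain v where v: "v \<noteq> 0" "g \<bullet> v \<le> 0"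
    using nonzero_Basis by (cases "g = 0") (fastforce, metis inner_minus_right neg_le_0_iff_le
        neg_equal_0_iff_equal inner_ge_zero)
  have "filterlim (\<lambda>n. norm v * real n) at_top sequentially"
    using v(1) by (intro filterlim_tendsto_pos_mult_at_top[OF tendsto_const _ filterlim_real_sequentially]) simp
  then have "filterlim (\<lambda>n. real n *\<^sub>R v) at_infinity sequentially"
    unfolding filterlim_at_infinity_conv_norm_at_top by (simp add: mult.commute)
  then have "filterlim (\<lambda>n. f (real n *\<^sub>R v)) at_top sequentially"
    using assms unfolding coercive_def by (rule filterlim_compose[rotated])
  then obtain n where "b + 1 \<le> f (real n *\<^sub>R v)"
    unfolding filterlim_at_top by (auto dest!: spec[of _ "b + 1"] simp: eventually_sequentially)
  moreover have "g \<bullet> (real n *\<^sub>R v) \<le> 0" using v(2) by (simp add: mult_nonneg_nonpos)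
  ultimately show False using affine[rule_format, of "real n *\<^sub>R v"] by simp
qed

lemma coercive_lipschitz_constant_pos:
  fixes f :: "'a::euclidean_space \<Rightarrow> real"
  assumes "coercive f" and G: "\<And>z. GDERIV f z :> g z"
    and Lip: "\<And>z w. norm (g z - g w) \<le> L * norm (z - w)"
  shows "L > 0"
proof (rule ccontr)
  assume "\<not> L > 0"
  then have "f (0 + e) \<le> f 0 + g 0 \<bullet> e" for e
    using lipschitz_gradient_upper_bound[OF G Lip, of 0 e]
    by (smt (verit) mult_nonpos_nonneg zero_le_power2 divide_nonpos_pos)
  then show False using coercive_not_affinely_bounded[OF assms(1)] by auto
qed

lemma quadratic_form_positive_definite:
  fixes H :: "real^'n^'q" and V0 :: "real^'n^'r"
  assumes ker: "\<And>z. H *v z = 0 \<Longrightarrow> V0 *v z = 0 \<Longrightarrow> z = 0" and "a > 0" "b > 0"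
  shows "\<exists>\<nu>>0. \<forall>d. \<nu> * (norm d)\<^sup>2 \<le> a * (norm (H *v d))\<^sup>2 + b * (norm (V0 *v d))\<^sup>2"
proof -
  define Q where "Q d = a * (norm (H *v d))\<^sup>2 + b * (norm (V0 *v d))\<^sup>2" for d
  have "sphere (0::real^'n) 1 \<noteq> {}"
    by (metis empty_iff mem_sphere_0 norm_axis_1)
  moreover have "continuous_on (sphere 0 1) Q"
    unfolding Q_def by (intro continuous_intros linear_continuous_on matrix_vector_mul_bounded_linear)
  ultimately obtain d0 where d0: "d0 \<in> sphere 0 1" "\<And>d. d \<in> sphere 0 1 \<Longrightarrow> Q d0 \<le> Q d"
    using continuous_attains_inf[OF compact_sphere] by blast
  have "Q d0 > 0"
  proof -
    have "d0 \<noteq> 0" using d0(1) by auto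
    then have "H *v d0 \<noteq> 0 \<or> V0 *v d0 \<noteq> 0" using ker by blast
    then show ?thesis using assms(2,3) by (auto simp: Q_def add_pos_nonneg add_nonneg_pos)
  qed
  moreover have "Q d0 * (norm d)\<^sup>2 \<le> Q d" for d
  proof (cases "d = 0")
    case False
    define e where "e = (1 / norm d) *\<^sub>R d"
    have "e \<in> sphere 0 1" using False by (simp add: e_def)
    moreover have "Q d = Q e * (norm d)\<^sup>2"
      using False by (simp add: Q_def e_def matrix_vector_mult_scaleR field_simps)
    ultimately show ?thesis using d0(2) mult_right_mono[of "Q d0" "Q e" "(norm d)\<^sup>2"] by simp
  qed (simp add: Q_def)
  ultimately show ?thesis unfolding Q_def by blast
qed

text \<open>Block \<open>s\<close> of the stacked operator, padded with zero rows, so that \<open>V\<^sub>s x - c\<^sub>s\<close> becomes an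
  affine map into the full space \<open>real^'p\<close>.\<close>

definition block_matrix :: "('p \<Rightarrow> 's) \<Rightarrow> real^'n^'p \<Rightarrow> 's \<Rightarrow> real^'n^'p" where
  "block_matrix grp V s = (\<chi> p. if grp p = s then V $ p else 0)"

definition block_vector :: "('p \<Rightarrow> 's) \<Rightarrow> real^'p \<Rightarrow> 's \<Rightarrow> real^'p" where
  "block_vector grp c s = (\<chi> p. if grp p = s then c $ p else 0)"

lemma block_matrix_vector_mult:
  "(block_matrix grp V s *v d) $ p = (if grp p = s then (V *v d) $ p else 0)"
  by (simp add: block_matrix_def matrix_vector_mult_def)

lemma blocknorm_eq_norm:
  fixes grp :: "'p::finite \<Rightarrow> 's"
  shows "blocknorm grp V c s x = norm (block_matrix grp V s *v x - block_vector grp c s)"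
proof -
  have "(norm (block_matrix grp V s *v x - block_vector grp c s))\<^sup>2
      = (\<Sum>p\<in>UNIV. if grp p = s then ((V *v x - c) $ p)\<^sup>2 else 0)"
    unfolding power2_norm_vec
    by (intro sum.cong) (auto simp: block_matrix_vector_mult block_vector_def)
  also have "\<dots> = (\<Sum>p\<in>{p. grp p = s}. ((V *v x - c) $ p)\<^sup>2)"
    by (simp add: sum.If_cases)
  finally have "(norm (block_matrix grp V s *v x - block_vector grp c s))\<^sup>2
      = (\<Sum>p\<in>{p. grp p = s}. ((V *v x - c) $ p)\<^sup>2)" .
  then show ?thesis unfolding blocknorm_def by (intro real_sqrt_unique) simp_all
qed

lemma sum_blocks_weighted_norm:
  fixes grp :: "'p::finite \<Rightarrow> 's::finite"
  shows "(\<Sum>s\<in>UNIV. w s * (norm (block_matrix grp V s *v d))\<^sup>2) = (\<Sum>p\<in>UNIV. w (grp p) * ((V *v d) $ p)\<^sup>2)"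
proof -
  have "(\<Sum>s\<in>UNIV. w s * (norm (block_matrix grp V s *v d))\<^sup>2)
      = (\<Sum>s\<in>UNIV. \<Sum>p\<in>UNIV. if grp p = s then w s * ((V *v d) $ p)\<^sup>2 else 0)"
    unfolding power2_norm_vec sum_distrib_left by (intro sum.cong) (auto simp: block_matrix_vector_mult)
  also have "\<dots> = (\<Sum>p\<in>UNIV. \<Sum>s\<in>UNIV. if grp p = s then w s * ((V *v d) $ p)\<^sup>2 else 0)"
    by (rule sum.swap)
  also have "\<dots> = (\<Sum>p\<in>UNIV. w (grp p) * ((V *v d) $ p)\<^sup>2)"
    by (intro sum.cong) (auto simp: eq_commute[of "grp _"])
  finally show ?thesis .
qed

lemma Amat_quadratic_form:
  fixes H :: "real^'n^'q" and V0 :: "real^'n^'r" and V :: "real^'n^'p"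
  shows "d \<bullet> (Amat \<mu> H V0 grp V c \<psi> \<delta> x *v d) = \<mu> * (norm (H *v d))\<^sup>2 + 2 * (norm (V0 *v d))\<^sup>2
     + (\<Sum>p\<in>UNIV. omega (\<psi> (grp p) \<delta>) (blocknorm grp V c (grp p) x) * ((V *v d) $ p)\<^sup>2)"
proof -
  define b where "b = (\<chi> p. omega (\<psi> (grp p) \<delta>) (blocknorm grp V c (grp p) x))"
  have "Amat \<mu> H V0 grp V c \<psi> \<delta> x *v d = \<mu> *\<^sub>R (transpose H *v (H *v d))
      + 2 *\<^sub>R (transpose V0 *v (V0 *v d)) + transpose V *v (Diag b *v (V *v d))"
    unfolding Amat_def b_def
    by (simp only: matrix_vector_mult_add_rdistrib scaleR_matrix_vector_assoc[symmetric]
        matrix_vector_mul_assoc matrix_mul_assoc)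
  moreover have "d \<bullet> (transpose H *v (H *v d)) = (norm (H *v d))\<^sup>2"
    and "d \<bullet> (transpose V0 *v (V0 *v d)) = (norm (V0 *v d))\<^sup>2"
    by (simp_all only: inner_matrix_vector_transpose[symmetric] power2_norm_eq_inner)
  moreover have "d \<bullet> (transpose V *v (Diag b *v (V *v d))) = (V *v d) \<bullet> (Diag b *v (V *v d))"
    by (simp only: inner_matrix_vector_transpose[symmetric])
  moreover have "\<dots> = (\<Sum>p\<in>UNIV. omega (\<psi> (grp p) \<delta>) (blocknorm grp V c (grp p) x) * ((V *v d) $ p)\<^sup>2)"
    unfolding inner_vec_def Diag_matrix_vector_mult b_def by (simp add: power2_eq_square mult_ac)
  ultimately show ?thesis by (simp add: inner_add_right)
qed

lemma Amat_symmetric: "transpose (Amat \<mu> H V0 grp V c \<psi> \<delta> x) = Amat \<mu> H V0 grp V c \<psi> \<delta> x"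
  unfolding Amat_def
  by (simp add: transpose_add transpose_scalar matrix_transpose_mul transpose_Diag matrix_mul_assoc)

locale half_quadratic_objective =
  fixes H :: "real^'n^'q" and y :: "real^'q" and V0 :: "real^'n^'r"
    and grp :: "'p::finite \<Rightarrow> 's::finite" and V :: "real^'n^'p" and c :: "real^'p"
    and \<Phi> :: "real^'q \<Rightarrow> real" and \<psi> :: "'s \<Rightarrow> real \<Rightarrow> real \<Rightarrow> real"
    and \<delta> L \<mu> :: real and \<omega>b :: "'s \<Rightarrow> real"
  assumes Phi_continuous: "continuous_on UNIV \<Phi>" and Phi_coercive: "coercive \<Phi>"
    and psi_nonneg: "\<And>s t. 0 \<le> \<psi> s \<delta> t"
    and kernels: "\<And>z. H *v z = 0 \<Longrightarrow> V0 *v z = 0 \<Longrightarrow> z = 0"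
    and Phi_gradient: "\<And>z. GDERIV \<Phi> z :> grad \<Phi> z"
    and Phi_lipschitz: "\<And>z w. norm (grad \<Phi> z - grad \<Phi> w) \<le> L * norm (z - w)"
    and psi_potential: "\<And>s. sqrt_concave_potential (\<psi> s \<delta>) (\<omega>b s)"
    and mu: "\<mu> \<ge> L"
begin

abbreviation "objective \<equiv> Fdelta \<Phi> H y V0 grp V c \<psi> \<delta>"
abbreviation "curvature \<equiv> Amat \<mu> H V0 grp V c \<psi> \<delta>"
abbreviation "B \<equiv> block_matrix grp V"
abbreviation "b \<equiv> block_vector grp c"

definition weight :: "'s \<Rightarrow> real^'n \<Rightarrow> real" where
  "weight s x = omega (\<psi> s \<delta>) (norm (B s *v x - b s))"

definition gradient :: "real^'n \<Rightarrow> real^'n" where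
  "gradient x = transpose H *v grad \<Phi> (H *v x - y)
     + (\<Sum>s\<in>UNIV. weight s x *\<^sub>R (transpose (B s) *v (B s *v x - b s)))
     + 2 *\<^sub>R (transpose V0 *v (V0 *v x))"

lemma objective_blocks:
  "objective x = \<Phi> (H *v x - y) + (\<Sum>s\<in>UNIV. \<psi> s \<delta> (norm (B s *v x - b s))) + (norm (V0 *v x))\<^sup>2"
  unfolding Fdelta_def blocknorm_eq_norm ..

lemma curvature_quadratic_form:
  "d \<bullet> (curvature x *v d) = \<mu> * (norm (H *v d))\<^sup>2 + 2 * (norm (V0 *v d))\<^sup>2
     + (\<Sum>p\<in>UNIV. weight (grp p) x * ((V *v d) $ p)\<^sup>2)"
  unfolding Amat_quadratic_form weight_def blocknorm_eq_norm ..

lemma weight_bounds: "0 \<le> weight s x" "weight s x \<le> \<omega>b s"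
  using sqrt_concave_potential.omega_bounds[OF psi_potential, of "norm (B s *v x - b s)" s]
  by (simp_all add: weight_def)

lemma has_gradient: "GDERIV objective x :> gradient x"
proof -
  have affine: "((\<lambda>x. H *v x - y) has_derivative (\<lambda>h. H *v h)) (at x)"
    by (auto intro!: derivative_eq_intros linear_imp_has_derivative)
  have "((\<lambda>x. \<Phi> (H *v x - y)) has_derivative (\<lambda>h. (H *v h) \<bullet> grad \<Phi> (H *v x - y))) (at x)"
    using has_derivative_compose[OF affine Phi_gradient[unfolded gderiv_def]] by simp
  moreover have "((\<lambda>x. \<Sum>s\<in>UNIV. \<psi> s \<delta> (norm (B s *v x - b s))) has_derivative
      (\<lambda>h. \<Sum>s\<in>UNIV. h \<bullet> (weight s x *\<^sub>R (transpose (B s) *v (B s *v x - b s))))) (at x)"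
    using sqrt_concave_potential.has_gradient_norm_affine[OF psi_potential]
    by (intro has_derivative_sum) (simp add: gderiv_def weight_def)
  moreover have "((\<lambda>x. V0 *v x) has_derivative (\<lambda>h. V0 *v h)) (at x)"
    by (auto intro!: linear_imp_has_derivative)
  from has_derivative_compose[OF this has_derivative_sqnorm_at[of "V0 *v x"]]
  have "((\<lambda>x. (norm (V0 *v x))\<^sup>2) has_derivative (\<lambda>h. 2 *\<^sub>R ((V0 *v x) \<bullet> (V0 *v h)))) (at x)"
    by simp
  ultimately have "(objective has_derivative (\<lambda>h. (H *v h) \<bullet> grad \<Phi> (H *v x - y)
      + (\<Sum>s\<in>UNIV. h \<bullet> (weight s x *\<^sub>R (transpose (B s) *v (B s *v x - b s))))
      + 2 *\<^sub>R ((V0 *v x) \<bullet> (V0 *v h)))) (at x)"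
    unfolding objective_blocks[abs_def] by (intro has_derivative_add)
  moreover have "(H *v h) \<bullet> grad \<Phi> (H *v x - y) = h \<bullet> (transpose H *v grad \<Phi> (H *v x - y))"
    and "(V0 *v x) \<bullet> (V0 *v h) = h \<bullet> (transpose V0 *v (V0 *v x))" for h
    by (rule inner_matrix_vector_transpose, subst inner_commute, rule inner_matrix_vector_transpose)
  ultimately show ?thesis
    unfolding gderiv_def gradient_def by (simp add: inner_add_right inner_sum_right)
qed

lemma grad_objective: "grad objective x = gradient x"
  by (rule grad_eqI[OF has_gradient])

lemma continuous_objective: "continuous_on UNIV objective"
  using has_gradient has_derivative_continuous unfolding gderiv_def
  by (blast intro: continuous_at_imp_continuous_on)

lemma mu_pos: "\<mu> > 0"
  using coercive_lipschitz_constant_pos[OF Phi_coercive Phi_gradient Phi_lipschitz] mu by simp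

lemma smooth_curvature_positive_definite:
  "\<exists>\<nu>>0. \<forall>d. \<nu> * (norm d)\<^sup>2 \<le> \<mu> * (norm (H *v d))\<^sup>2 + 2 * (norm (V0 *v d))\<^sup>2"
  using quadratic_form_positive_definite[of H V0 \<mu> 2] kernels mu_pos by simp

lemma curvature_lower: "\<exists>\<nu>>0. \<forall>x d. \<nu> * (norm d)\<^sup>2 \<le> d \<bullet> (curvature x *v d)"
proof -
  obtain \<nu> where \<nu>: "\<nu> > 0" "\<And>d. \<nu> * (norm d)\<^sup>2 \<le> \<mu> * (norm (H *v d))\<^sup>2 + 2 * (norm (V0 *v d))\<^sup>2"
    using smooth_curvature_positive_definite by blast
  have nonneg: "0 \<le> (\<Sum>p\<in>UNIV. weight (grp p) x * ((V *v d) $ p)\<^sup>2)" for x d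
    using weight_bounds by (intro sum_nonneg mult_nonneg_nonneg) auto
  have "\<nu> * (norm d)\<^sup>2 \<le> d \<bullet> (curvature x *v d)" for x d
    using \<nu>(2)[of d] nonneg[of x d] unfolding curvature_quadratic_form by linarith
  then show ?thesis using \<nu>(1) by blast
qed

lemma curvature_upper: "\<exists>\<nu>b. \<forall>x d. d \<bullet> (curvature x *v d) \<le> \<nu>b * (norm d)\<^sup>2"
proof -
  define W where "W = (\<Sum>s\<in>UNIV. \<omega>b s)"
  have \<omega>b: "0 \<le> \<omega>b s" for s
    using weight_bounds[of s 0] by linarith
  have W: "weight s x \<le> W" "0 \<le> W" for s x
    using weight_bounds(2)[of s x] member_le_sum[of s UNIV \<omega>b] \<omega>b
    by (simp_all add: W_def sum_nonneg)
  have "d \<bullet> (curvature x *v d) \<le> (\<mu> * (onorm ((*v) H))\<^sup>2 + 2 * (onorm ((*v) V0))\<^sup>2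
      + W * (onorm ((*v) V))\<^sup>2) * (norm d)\<^sup>2" for x d
  proof -
    have "(\<Sum>p\<in>UNIV. weight (grp p) x * ((V *v d) $ p)\<^sup>2) \<le> (\<Sum>p\<in>UNIV. W * ((V *v d) $ p)\<^sup>2)"
      using W by (intro sum_mono mult_right_mono) auto
    also have "\<dots> = W * (norm (V *v d))\<^sup>2"
      by (simp add: power2_norm_vec sum_distrib_left)
    also have "\<dots> \<le> W * ((onorm ((*v) V))\<^sup>2 * (norm d)\<^sup>2)"
      using W(2) by (intro mult_left_mono power2_norm_matrix_vector_le)
    finally have "(\<Sum>p\<in>UNIV. weight (grp p) x * ((V *v d) $ p)\<^sup>2)
        \<le> W * ((onorm ((*v) V))\<^sup>2 * (norm d)\<^sup>2)" .
    moreover have "\<mu> * (norm (H *v d))\<^sup>2 \<le> \<mu> * ((onorm ((*v) H))\<^sup>2 * (norm d)\<^sup>2)"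
      using mu_pos power2_norm_matrix_vector_le by (intro mult_left_mono) auto
    moreover have "2 * (norm (V0 *v d))\<^sup>2 \<le> 2 * ((onorm ((*v) V0))\<^sup>2 * (norm d)\<^sup>2)"
      using power2_norm_matrix_vector_le by (intro mult_left_mono) auto
    ultimately show ?thesis unfolding curvature_quadratic_form by (simp add: algebra_simps)
  qed
  then show ?thesis by blast
qed

lemma smooth_part_majorant:
  "\<Phi> (H *v (x + d) - y) \<le> \<Phi> (H *v x - y)
     + (transpose H *v grad \<Phi> (H *v x - y)) \<bullet> d + \<mu> / 2 * (norm (H *v d))\<^sup>2"
proof -
  have "\<Phi> ((H *v x - y) + H *v d)
      \<le> \<Phi> (H *v x - y) + grad \<Phi> (H *v x - y) \<bullet> (H *v d) + L / 2 * (norm (H *v d))\<^sup>2"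
    by (rule lipschitz_gradient_upper_bound[OF Phi_gradient Phi_lipschitz])
  moreover have "L / 2 * (norm (H *v d))\<^sup>2 \<le> \<mu> / 2 * (norm (H *v d))\<^sup>2"
    using mu by (intro mult_right_mono) auto
  moreover have "grad \<Phi> (H *v x - y) \<bullet> (H *v d) = (transpose H *v grad \<Phi> (H *v x - y)) \<bullet> d"
    by (subst (1 2) inner_commute) (rule inner_matrix_vector_transpose)
  ultimately show ?thesis by (simp add: algebra_simps)
qed

lemma potentials_majorant:
  "(\<Sum>s\<in>UNIV. \<psi> s \<delta> (norm (B s *v (x + d) - b s)))
     \<le> (\<Sum>s\<in>UNIV. \<psi> s \<delta> (norm (B s *v x - b s)))
       + (\<Sum>s\<in>UNIV. weight s x *\<^sub>R (transpose (B s) *v (B s *v x - b s))) \<bullet> d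
       + 1/2 * (\<Sum>p\<in>UNIV. weight (grp p) x * ((V *v d) $ p)\<^sup>2)"
proof -
  have "(\<Sum>s\<in>UNIV. \<psi> s \<delta> (norm (B s *v (x + d) - b s)))
      \<le> (\<Sum>s\<in>UNIV. \<psi> s \<delta> (norm (B s *v x - b s))
        + (weight s x *\<^sub>R (transpose (B s) *v (B s *v x - b s))) \<bullet> d
        + weight s x / 2 * (norm (B s *v d))\<^sup>2)"
    using sqrt_concave_potential.norm_affine_majorant[OF psi_potential]
    by (intro sum_mono) (simp add: weight_def)
  also have "\<dots> = (\<Sum>s\<in>UNIV. \<psi> s \<delta> (norm (B s *v x - b s)))
      + (\<Sum>s\<in>UNIV. weight s x *\<^sub>R (transpose (B s) *v (B s *v x - b s))) \<bullet> d
      + 1/2 * (\<Sum>s\<in>UNIV. weight s x * (norm (B s *v d))\<^sup>2)"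
    by (simp add: sum.distrib inner_sum_left sum_distrib_left)
  also have "(\<Sum>s\<in>UNIV. weight s x * (norm (B s *v d))\<^sup>2)
      = (\<Sum>p\<in>UNIV. weight (grp p) x * ((V *v d) $ p)\<^sup>2)"
    by (rule sum_blocks_weighted_norm)
  finally show ?thesis .
qed

lemma majorant:
  "objective (x + d) \<le> objective x + gradient x \<bullet> d + 1/2 * (d \<bullet> (curvature x *v d))"
proof -
  have "(V0 *v x) \<bullet> (V0 *v d) = (transpose V0 *v (V0 *v x)) \<bullet> d"
    by (subst (1 2) inner_commute) (rule inner_matrix_vector_transpose)
  then have "(norm (V0 *v (x + d)))\<^sup>2
      = (norm (V0 *v x))\<^sup>2 + (2 *\<^sub>R (transpose V0 *v (V0 *v x))) \<bullet> d + (norm (V0 *v d))\<^sup>2"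
    by (simp add: matrix_vector_right_distrib power2_norm_eq_inner inner_add_left inner_add_right
        inner_commute)
  then show ?thesis
    using smooth_part_majorant[of x d] potentials_majorant[of x d]
    unfolding objective_blocks gradient_def curvature_quadratic_form inner_add_left
    by (simp add: algebra_simps)
qed

lemma bounded_sublevel: "bounded {x. objective x \<le> C}"
proof -
  obtain m where m: "\<And>z. m \<le> \<Phi> z"
    using coercive_bounded_below[OF Phi_continuous Phi_coercive] by blast
  obtain \<nu> where \<nu>: "\<nu> > 0" "\<And>d. \<nu> * (norm d)\<^sup>2 \<le> \<mu> * (norm (H *v d))\<^sup>2 + 2 * (norm (V0 *v d))\<^sup>2"
    using smooth_curvature_positive_definite by blast
  have "eventually (\<lambda>z. C + 1 \<le> \<Phi> z) at_infinity"
    using Phi_coercive unfolding coercive_def filterlim_at_top by blast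
  then obtain R where R: "\<And>z. R \<le> norm z \<Longrightarrow> C + 1 \<le> \<Phi> z"
    unfolding eventually_at_infinity by blast
  have "norm x \<le> sqrt ((\<mu> * (max R 0 + norm y)\<^sup>2 + 2 * (C - m)) / \<nu>)" if "objective x \<le> C" for x
  proof (rule real_le_rsqrt)
    have "0 \<le> (\<Sum>s\<in>UNIV. \<psi> s \<delta> (norm (B s *v x - b s)))"
      using psi_nonneg by (intro sum_nonneg) auto
    then have sub: "\<Phi> (H *v x - y) + (norm (V0 *v x))\<^sup>2 \<le> C"
      using that unfolding objective_blocks by simp
    then have "norm (H *v x - y) < R"
      using R[of "H *v x - y"] zero_le_power2[of "norm (V0 *v x)"] by linarith
    then have "norm (H *v x) \<le> max R 0 + norm y"
      using norm_triangle_ineq2[of "H *v x" y] by simp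
    then have "\<mu> * (norm (H *v x))\<^sup>2 \<le> \<mu> * (max R 0 + norm y)\<^sup>2"
      using mu_pos by (intro mult_left_mono power_mono) auto
    moreover have "2 * (norm (V0 *v x))\<^sup>2 \<le> 2 * (C - m)" using sub m[of "H *v x - y"] by simp
    ultimately have "\<nu> * (norm x)\<^sup>2 \<le> \<mu> * (max R 0 + norm y)\<^sup>2 + 2 * (C - m)"
      using \<nu>(2)[of x] by linarith
    then show "(norm x)\<^sup>2 \<le> (\<mu> * (max R 0 + norm y)\<^sup>2 + 2 * (C - m)) / \<nu>"
      using \<nu>(1) by (simp add: field_simps)
  qed
  then show ?thesis unfolding bounded_iff by blast
qed

lemma quadratic_majorant_kl:
  assumes "KL objective"
  shows "\<exists>\<nu> \<nu>b. quadratic_majorant_kl objective gradient curvature \<nu> \<nu>b"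
proof -
  obtain \<nu> where "\<nu> > 0" "\<And>x d. \<nu> * (norm d)\<^sup>2 \<le> d \<bullet> (curvature x *v d)"
    using curvature_lower by blast
  moreover obtain \<nu>b where "\<And>x d. d \<bullet> (curvature x *v d) \<le> \<nu>b * (norm d)\<^sup>2"
    using curvature_upper by blast
  ultimately have "quadratic_majorant_kl objective gradient curvature \<nu> \<nu>b"
    using assms majorant Amat_symmetric has_gradient continuous_objective bounded_sublevel
    by unfold_locales auto
  then show ?thesis by blast
qed

end

theorem theorem3:
  fixes H :: "real^'n^'q" and y :: "real^'q" and V0 :: "real^'n^'r"
    and grp :: "'p::finite \<Rightarrow> 's::finite" and V :: "real^'n^'p" and c :: "real^'p"
    and \<Phi> :: "real^'q \<Rightarrow> real" and \<psi> :: "'s \<Rightarrow> real \<Rightarrow> real \<Rightarrow> real"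
    and \<delta> L \<mu> :: real and J :: nat and \<omega>bar :: "'s \<Rightarrow> real"
    and x :: "nat \<Rightarrow> real^'n" and D :: "nat \<Rightarrow> real^'m^'n"
    and u :: "nat \<Rightarrow> nat \<Rightarrow> real^'m" and j1 :: 'm
  defines "F \<equiv> Fdelta \<Phi> H y V0 grp V c \<psi> \<delta>"
  defines "A \<equiv> Amat \<mu> H V0 grp V c \<psi> \<delta>"
  assumes MN: "CARD('m) \<le> CARD('n)"
    and J: "J \<ge> 1"
    and H_nz: "H \<noteq> 0"
    and blocks_nonempty: "surj grp"
    \<comment> \<open>(A1)\<close>
    and A1i: "continuous_on UNIV \<Phi>" "coercive \<Phi>"
    and A1ii: "\<And>s d. d > 0 \<Longrightarrow> continuous_on UNIV (\<psi> s d) \<and> (\<forall>t. \<psi> s d t \<ge> 0)"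
    and A1iii: "\<And>z. H *v z = 0 \<Longrightarrow> V0 *v z = 0 \<Longrightarrow> z = 0"
    \<comment> \<open>(A3) for the fixed delta\<close>
    and delta_pos: "\<delta> > 0"
    and A3i: "\<And>z. GDERIV \<Phi> z :> grad \<Phi> z"
      "\<And>z w. norm (grad \<Phi> z - grad \<Phi> w) \<le> L * norm (z - w)"
    and A3ii: "\<And>s t. \<psi> s \<delta> differentiable (at t)"
    and A3iii: "\<And>s. concave_on {0..} (\<lambda>t. \<psi> s \<delta> (sqrt t))"
    and A3iv: "\<And>s. \<omega>bar s \<ge> 0"
      "\<And>s t. t > 0 \<Longrightarrow> 0 \<le> deriv (\<psi> s \<delta>) t \<and> deriv (\<psi> s \<delta>) t \<le> \<omega>bar s * t"
      "\<And>s. \<exists>l::real. ((\<lambda>t. deriv (\<psi> s \<delta>) t / t) \<longlongrightarrow> l) (at 0)"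
    and KL: "KL F"
    and mu: "\<mu> \<ge> L"
    \<comment> \<open>MM subspace iteration\<close>
    and u0: "\<And>k. u k 0 = 0"
    and uj: "\<And>k j. 1 \<le> j \<Longrightarrow> j \<le> J \<Longrightarrow>
       u k j = u k (j - 1)
         - pinv (transpose (D k) ** A (x k + D k *v u k (j - 1)) ** D k)
             *v (transpose (D k) *v grad F (x k + D k *v u k (j - 1)))"
    and xstep: "\<And>k. x (Suc k) = x k + D k *v u k J"
    \<comment> \<open>(A4), j1 indexes the first column of D k\<close>
    and A4: "\<exists>\<gamma>0>0. \<exists>\<gamma>1>0. \<forall>k.
       grad F (x k) \<bullet> column j1 (D k) \<le> - \<gamma>0 * (norm (grad F (x k)))\<^sup>2 \<and>
       norm (column j1 (D k)) \<le> \<gamma>1 * norm (grad F (x k))"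
  shows "\<exists>xt. x \<longlonglongrightarrow> xt \<and> grad F xt = 0 \<and> summable (\<lambda>k. norm (x (Suc k) - x k))"
proof -
  interpret half_quadratic_objective H y V0 grp V c \<Phi> \<psi> \<delta> L \<mu> \<omega>bar
    using A1i A1ii[OF delta_pos] A1iii A3i A3ii A3iii A3iv(2,3) mu by unfold_locales auto
  obtain \<nu> \<nu>b where "quadratic_majorant_kl F gradient A \<nu> \<nu>b"
    using quadratic_majorant_kl KL unfolding F_def A_def by blast
  then interpret mm: quadratic_majorant_kl F gradient A \<nu> \<nu>b .
  have grad_F: "grad F = gradient" unfolding F_def by (rule ext) (rule grad_objective)
  from mm.subspace_iteration_converges[OF J u0 uj[unfolded grad_F] xstep A4[unfolded grad_F]]
  show ?thesis unfolding grad_F .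
qed

end
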